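(* Every homogeneous polynomial of degree $9$ in $\mathbb{C}[x_{ijk}\mid 1\le i,j,k\le 3]$ that is invariant under the action of $SL_3(\mathbb{C})\times SL_3(\mathbb{C})\times SL_3(\mathbb{C})$ on $3\times3\times3$ arrays $X=(x_{ijk})$ is a scalar multiple of $$\begin{aligned}&\mathcal{O}^-(x_{123}x_{132}x_{133}x_{213}x_{221}x_{232}x_{311}^2x_{322})+\mathcal{O}^-(x_{123}x_{132}x_{133}x_{213}x_{221}x_{231}x_{312}^2x_{321})\\&+\mathcal{O}^-(x_{123}x_{132}x_{133}x_{213}x_{221}x_{222}x_{311}x_{312}x_{331})+\mathcal{O}^-(x_{123}x_{132}x_{133}x_{213}x_{221}^2x_{311}x_{312}x_{332})\\&+\mathcal{O}^-(x_{123}x_{132}x_{133}x_{212}x_{223}x_{231}x_{311}x_{312}x_{321})+\mathcal{O}^-(x_{123}x_{132}x_{133}x_{212}x_{222}x_{231}x_{311}^2x_{323})\\&+\mathcal{O}^-(x_{123}x_{132}x_{133}x_{212}x_{221}x_{232}x_{311}x_{313}x_{321})+\mathcal{O}^-(x_{123}x_{132}x_{133}x_{212}x_{221}x_{231}x_{311}x_{313}x_{322})\\&+\mathcal{O}^-(x_{123}x_{132}x_{133}x_{212}x_{213}x_{221}x_{312}x_{321}x_{331})+\mathcal{O}^-(x_{123}x_{132}x_{133}x_{212}^2x_{231}x_{313}x_{321}^2)\\&+\mathcal{O}^-(x_{123}x_{132}x_{133}x_{211}x_{212}x_{232}x_{311}x_{321}x_{323})+\mathcal{O}^-(x_{123}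x_{132}^2x_{213}x_{221}x_{231}x_{311}x_{312}x_{323})\\&+\mathcal{O}^-(x_{123}x_{132}^2x_{213}x_{221}x_{222}x_{311}^2x_{333})+\mathcal{O}^-(x_{123}x_{132}^2x_{213}^2x_{231}x_{312}x_{321}^2).\end{aligned}$$
   Context: A triple $(A,B,C)$ of invertible $3\times 3$ complex matrices acts on $\mathbb{C}[x_{ijk}]$ by algebra automorphisms with $(A,B,C)\cdot x_{ijk}=\sum_{p,q,r=1}^3 a_{pi}b_{qj}c_{rk}x_{pqr}$. A polynomial $f$ is an invariant if $(A,B,C)\cdot f=f$ whenever $\det A=\det B=\det C=1$. For a $3\times3\times3$ array $E=(e_{ijk})$ of non-negative integers, $M(E)=\prod_{i,j,k}x_{ijk}^{e_{ijk}}$. The finite group $G=(S_3\times S_3\times S_3)\rtimes S_3$ acts on arrays by $((\alpha,\beta,\gamma)\cdot E)_{i,j,k}=e_{\alpha(i),\beta(j),\gamma(k)}$, and $\delta$ in the last $S_3$ permutes the three directions: $(\delta\cdot E)_{t_1,t_2,t_3}=e_{t_{\delta(1)},t_{\delta(2)},t_{\delta(3)}}$. The orbit of $M=M(E)$ is $\mathcal{O}(M)=\{M(g\cdot E)\mid g\in G\}$ and the alternating orbit sum is $\mathcal{O}^-(M)=\frac{|\mathcal{O}(M)|}{|G|}\sum_{g\in G}\epsilon(g)M(g\cdot E)$, where $\epsilon(g)$ is the product of the signs of the four components of $g=(\alpha,\beta,\gamma,\delta)$. *)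

theory Defs
  imports "HOL-Analysis.Analysis" "HOL-Library.Poly_Mapping"
begin

text \<open>
  The index set \<open>{1, 2, 3}\<close> is the three-element type \<^typ>\<open>3\<close>. Its elements are
  \<open>1\<close>, \<open>2\<close>, \<open>3\<close>, which are pairwise distinct (the numeral \<open>3\<close> denotes the same element as \<open>0\<close>).
\<close>

type_synonym monom = "(3 \<times> 3 \<times> 3) \<Rightarrow>\<^sub>0 nat"

type_synonym array_poly = "monom \<Rightarrow>\<^sub>0 complex"

definition var :: "3 \<Rightarrow> 3 \<Rightarrow> 3 \<Rightarrow> array_poly" where
  "var i j k = Poly_Mapping.single (Poly_Mapping.single (i, j, k) 1) 1"

definition const :: "complex \<Rightarrow> array_poly" where
  "const c = Poly_Mapping.single 0 c"

text \<open>The zero polynomial is homogeneous of every degree.\<close>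

definition homogeneous_of_degree :: "nat \<Rightarrow> array_poly \<Rightarrow> bool" where
  "homogeneous_of_degree d f \<longleftrightarrow>
     (\<forall>m \<in> Poly_Mapping.keys f. (\<Sum>v\<in>UNIV. Poly_Mapping.lookup m v) = d)"

text \<open>The algebra endomorphism sending the variable with index \<open>v\<close> to \<open>s v\<close>.\<close>

definition subst :: "(3 \<times> 3 \<times> 3 \<Rightarrow> array_poly) \<Rightarrow> array_poly \<Rightarrow> array_poly" where
  "subst s f = (\<Sum>m \<in> Poly_Mapping.keys f.
     const (Poly_Mapping.lookup f m) * (\<Prod>v\<in>UNIV. s v ^ Poly_Mapping.lookup m v))"

definition act :: "complex^3^3 \<Rightarrow> complex^3^3 \<Rightarrow> complex^3^3 \<Rightarrow> array_poly \<Rightarrow> array_poly" where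
  "act A B C = subst (\<lambda>(i, j, k).
     \<Sum>p\<in>UNIV. \<Sum>q\<in>UNIV. \<Sum>r\<in>UNIV. const (A $ p $ i * B $ q $ j * C $ r $ k) * var p q r)"

definition SL3_invariant :: "array_poly \<Rightarrow> bool" where
  "SL3_invariant f \<longleftrightarrow>
     (\<forall>A B C. det A = 1 \<and> det B = 1 \<and> det C = 1 \<longrightarrow> act A B C f = f)"

type_synonym exponent_array = "3 \<Rightarrow> 3 \<Rightarrow> 3 \<Rightarrow> nat"

definition monomial_of :: "exponent_array \<Rightarrow> array_poly" where
  "monomial_of E = (\<Prod>i\<in>UNIV. \<Prod>j\<in>UNIV. \<Prod>k\<in>UNIV. var i j k ^ E i j k)"

text \<open>
  The exponent array of a monomial written as a list of variable indices, repeated according to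
  multiplicity; see \<open>monomial_of_array_of\<close> below.
\<close>

definition array_of :: "(3 \<times> 3 \<times> 3) list \<Rightarrow> exponent_array" where
  "array_of ts = (\<lambda>i j k. count_list ts (i, j, k))"

type_synonym symmetry = "(3 \<Rightarrow> 3) \<times> (3 \<Rightarrow> 3) \<times> (3 \<Rightarrow> 3) \<times> (3 \<Rightarrow> 3)"

definition symmetries :: "symmetry set" where
  "symmetries = {(\<alpha>, \<beta>, \<gamma>, \<delta>).
     \<alpha> permutes UNIV \<and> \<beta> permutes UNIV \<and> \<gamma> permutes UNIV \<and> \<delta> permutes UNIV}"

definition permute_entries ::
  "(3 \<Rightarrow> 3) \<Rightarrow> (3 \<Rightarrow> 3) \<Rightarrow> (3 \<Rightarrow> 3) \<Rightarrow> exponent_array \<Rightarrow> exponent_array" where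
  "permute_entries \<alpha> \<beta> \<gamma> E = (\<lambda>i j k. E (\<alpha> i) (\<beta> j) (\<gamma> k))"

definition permute_directions :: "(3 \<Rightarrow> 3) \<Rightarrow> exponent_array \<Rightarrow> exponent_array" where
  "permute_directions \<delta> E = (\<lambda>t1 t2 t3.
     let t = (\<lambda>n. if n = 1 then t1 else if n = 2 then t2 else t3)
     in E (t (\<delta> 1)) (t (\<delta> 2)) (t (\<delta> 3)))"

text \<open>
  The element \<open>(\<alpha>, \<beta>, \<gamma>, \<delta>)\<close> acts by \<open>\<delta>\<close> first. Composing in the other order only permutes
  \<open>\<alpha>\<close>, \<open>\<beta>\<close>, \<open>\<gamma>\<close> among themselves, which preserves the sign, so neither the orbit nor the
  alternating orbit sum depends on this choice.
\<close>

fun permute_array :: "symmetry \<Rightarrow> exponent_array \<Rightarrow> exponent_array" where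
  "permute_array (\<alpha>, \<beta>, \<gamma>, \<delta>) E = permute_entries \<alpha> \<beta> \<gamma> (permute_directions \<delta> E)"

fun symmetry_sign :: "symmetry \<Rightarrow> int" where
  "symmetry_sign (\<alpha>, \<beta>, \<gamma>, \<delta>) = sign \<alpha> * sign \<beta> * sign \<gamma> * sign \<delta>"

definition monomial_orbit :: "exponent_array \<Rightarrow> array_poly set" where
  "monomial_orbit E = {monomial_of (permute_array g E) | g. g \<in> symmetries}"

definition alternating_orbit_sum :: "exponent_array \<Rightarrow> array_poly" where
  "alternating_orbit_sum E =
     const (of_nat (card (monomial_orbit E)) / of_nat (card symmetries)) *
     (\<Sum>g\<in>symmetries. of_int (symmetry_sign g) * monomial_of (permute_array g E))"


lemma const_0 [simp]: "const 0 = 0"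
  and const_1 [simp]: "const 1 = 1"
  and const_add: "const (a + b) = const a + const b"
  and const_mult: "const (a * b) = const a * const b"
  by (simp_all add: const_def single_add mult_single flip: single_one)

lemma subst_eq:
  assumes "finite K" "Poly_Mapping.keys f \<subseteq> K"
  shows "subst s f = (\<Sum>m\<in>K.
     const (Poly_Mapping.lookup f m) * (\<Prod>v\<in>UNIV. s v ^ Poly_Mapping.lookup m v))"
  unfolding subst_def
  by (rule sum.mono_neutral_left) (use assms in \<open>auto simp: in_keys_iff\<close>)

lemma subst_add: "subst s (f + g) = subst s f + subst s g"
proof -
  let ?K = "Poly_Mapping.keys f \<union> Poly_Mapping.keys g"
  have "Poly_Mapping.keys (f + g) \<subseteq> ?K"
    by (rule Poly_Mapping.keys_add)
  then show ?thesis
    by (simp add: subst_eq[of ?K] lookup_add const_add distrib_right sum.distrib)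
qed

lemma subst_single:
  "subst s (Poly_Mapping.single m c) = const c * (\<Prod>v\<in>UNIV. s v ^ Poly_Mapping.lookup m v)"
  by (simp add: subst_eq[of "{m}"])

lemma subst_const [simp]: "subst s (const c) = const c"
  by (simp add: const_def[of c] subst_single)

lemma subst_0 [simp]: "subst s 0 = 0"
  by (simp add: subst_def)

lemma array_poly_induct [case_names zero plus]:
  fixes f :: array_poly
  assumes "P 0" and "\<And>m c g. P g \<Longrightarrow> P (Poly_Mapping.single m c + g)"
  shows "P f"
proof -
  have "P (\<Sum>m\<in>K. Poly_Mapping.single m (Poly_Mapping.lookup f m))" if "finite K" for K
    using that by induction (use assms in auto)
  moreover have "f = (\<Sum>m\<in>Poly_Mapping.keys f. Poly_Mapping.single m (Poly_Mapping.lookup f m))"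
    by (rule poly_mapping_eqI) (auto simp: lookup_sum lookup_single when_def in_keys_iff)
  ultimately show ?thesis by (metis finite_keys)
qed

lemma subst_mult: "subst s (f * g) = subst s f * subst s g"
proof (induction f rule: array_poly_induct)
  case zero
  show ?case by simp
next
  case (plus m c f)
  have "subst s (Poly_Mapping.single m c * g) = subst s (Poly_Mapping.single m c) * subst s g"
  proof (induction g rule: array_poly_induct)
    case zero
    show ?case by simp
  next
    case (plus n d g)
    then show ?case
      by (simp add: distrib_left subst_add)
        (simp add: mult_single subst_single const_mult lookup_add power_add prod.distrib mult_ac)
  qed
  then show ?case using plus by (simp add: distrib_right subst_add)
qed

lemma subst_var [simp]: "subst s (var i j k) = s (i, j, k)"
proof -
  have "(\<Prod>v\<in>UNIV. s v ^ Poly_Mapping.lookup (Poly_Mapping.single (i, j, k) (1::nat)) v)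
      = (\<Prod>v\<in>UNIV. if v = (i, j, k) then s v else 1)"
    by (rule prod.cong) (auto simp: lookup_single when_def)
  then show ?thesis
    by (simp add: var_def subst_single)
qed

lemma act_var:
  "act A B C (var i j k) =
     (\<Sum>p\<in>UNIV. \<Sum>q\<in>UNIV. \<Sum>r\<in>UNIV. const (A $ p $ i * B $ q $ j * C $ r $ k) * var p q r)"
  by (simp add: act_def)

lemma monomial_of_eq: "monomial_of E = (\<Prod>(i, j, k)\<in>UNIV. var i j k ^ E i j k)"
  unfolding monomial_of_def prod.cartesian_product UNIV_Times_UNIV
  by (rule prod.cong) auto

lemma monomial_of_array_of:
  "monomial_of (array_of ts) = prod_list (map (\<lambda>(i, j, k). var i j k) ts)"
proof (induction ts)
  case Nil
  then show ?case by (simp add: monomial_of_def array_of_def)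
next
  case (Cons t ts)
  obtain a b c where t: "t = (a, b, c)" by (cases t) auto
  have "monomial_of (array_of (t # ts)) =
      (\<Prod>v\<in>UNIV. (if v = t then var a b c else 1) *
         (case v of (i, j, k) \<Rightarrow> var i j k ^ array_of ts i j k))"
    unfolding monomial_of_eq
    by (rule prod.cong) (auto simp: array_of_def t split: if_splits)
  also have "\<dots> = var a b c * monomial_of (array_of ts)"
    by (simp add: prod.distrib monomial_of_eq)
  finally show ?case using Cons by (simp add: t)
qed

end

theory Submission
  imports Defs "HOL-Computational_Algebra.Polynomial"
begin

text \<open>
  An invariant of degree 9 is a solution of a linear system in its coefficients, and that system is
  small enough to be solved.  Invariance supplies three kinds of equations.  Diagonal matrices show
  that only monomials whose exponent array has all nine slice sums equal to 3 occur
  (\<open>first_balanced\<close>).  A permutation matrix, multiplied by its sign so as to have determinant 1,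
  shows that permuting the values of one of the three indices multiplies every coefficient by the
  sign of the permutation, because 9 is odd (\<open>coef_permute_first\<close>).  The unipotent matrices
  \<open>1 + t E\<close>, with \<open>E\<close> a matrix unit, give a raising operator that annihilates the polynomial, and each
  coefficient of the result is a linear relation (\<open>raising_relation\<close>).  Those used here have two or
  three terms.  Finally, interchanging two directions of the array turns invariants into
  invariants.

  The claim becomes finite as follows.  Let \<open>m\<close> be the last of the fourteen monomials of the
  theorem.  The proof works with statements of the form "for every invariant \<open>f\<close>, the coefficient of
  \<open>f\<close> at \<open>n\<close> is \<open>q\<close> times its coefficient at \<open>m\<close>" (\<open>determined\<close>).  Such statements are about all
  invariants at once, and each interchange of two directions has the same effect on \<open>m\<close> as an odd
  element of \<open>S\<^sub>3 \<times> S\<^sub>3 \<times> S\<^sub>3\<close>, permuting values.  Hence they can be transported along the whole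
  group \<open>G\<close> of symmetries, with a factor \<open>-1\<close> for every generator
  (\<open>determined_move\<close>).  It is therefore enough to treat one monomial from each of the 44 orbits of
  \<open>G\<close> on balanced arrays.  In 13 orbits the coefficient vanishes because an odd element
  of \<open>S\<^sub>3 \<times> S\<^sub>3 \<times> S\<^sub>3\<close> fixes a monomial; \<open>m\<close> itself is one of the fourteen; for each of the remaining 30 orbits
  there is a raising relation in which a single term is not yet known.  Exactly the fourteen orbits
  of the theorem get \<open>q = 1\<close>, the others get \<open>q = 0\<close> (\<open>table_determined\<close>, \<open>table_leading\<close>).
  That no orbit has been forgotten is \<open>balanced_in_table\<close>.

  As all coefficients are multiples of the one at \<open>m\<close>, the invariant alternates under \<open>G\<close>.  For an
  alternating polynomial \<open>f\<close>, the orbit-stabilizer theorem says that the value of \<open>f\<close> at \<open>E\<close> times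
  the alternating orbit sum of \<open>E\<close> is the part of \<open>f\<close> that is supported on the orbit of \<open>E\<close>
  (\<open>cell_coef_alternating_orbit_sum\<close>).  Adding this up over the fourteen orbits, which are pairwise
  distinct (\<open>walks_leading\<close>), gives the theorem (\<open>invariant_expansion\<close>).
\<close>

section \<open>Monomials as lists of positions\<close>

type_synonym position = "3 \<times> 3 \<times> 3"

definition mon :: "position list \<Rightarrow> monom" where
  "mon ts = (\<Sum>t\<leftarrow>ts. Poly_Mapping.single t 1)"

definition coef :: "array_poly \<Rightarrow> position list \<Rightarrow> complex" where
  "coef f ts = Poly_Mapping.lookup f (mon ts)"

definition X :: "position \<Rightarrow> array_poly" where
  "X t = Poly_Mapping.single (Poly_Mapping.single t 1) 1"

lemma lookup_mon: "Poly_Mapping.lookup (mon ts) v = count_list ts v"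
  by (induction ts) (auto simp: mon_def lookup_add lookup_single when_def)

lemma mon_eq_iff: "mon ts = mon us \<longleftrightarrow> mset ts = mset us"
  by (auto simp: poly_mapping_eq_iff fun_eq_iff lookup_mon multiset_eq_iff count_mset)

lemma mon_surj: obtains ts where "m = mon ts"
proof -
  obtain ts where "mset ts = (\<Sum>v\<in>UNIV. replicate_mset (Poly_Mapping.lookup m v) v)"
    using ex_mset by blast
  then have "count_list ts v = Poly_Mapping.lookup m v" for v
    by (simp add: count_sum flip: count_mset)
  then have "m = mon ts"
    by (intro poly_mapping_eqI) (simp add: lookup_mon)
  then show ?thesis by (rule that)
qed

lemma coef_cong: "mset ts = mset us \<Longrightarrow> coef f ts = coef f us"
  by (simp add: coef_def flip: mon_eq_iff)

lemma array_poly_eqI: "(\<And>ts. coef f ts = coef g ts) \<Longrightarrow> f = g"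
  by (metis coef_def mon_surj poly_mapping_eqI)

lemma lookup_const_mult: "Poly_Mapping.lookup (const c * p) m = c * Poly_Mapping.lookup p m"
  by (induction p rule: array_poly_induct)
    (auto simp: const_def distrib_left mult_single lookup_add lookup_single when_def)

lemma coef_zero [simp]: "coef 0 ts = 0"
  and coef_add: "coef (f + g) ts = coef f ts + coef g ts"
  and coef_const_mult: "coef (const c * f) ts = c * coef f ts"
  by (simp_all add: coef_def lookup_add lookup_const_mult)

lemma coef_sum: "coef (sum g I) ts = (\<Sum>i\<in>I. coef (g i) ts)"
  by (simp add: coef_def lookup_sum)

lemma coef_single: "coef (Poly_Mapping.single (mon us) c) ts = (if mset us = mset ts then c else 0)"
  by (simp add: coef_def lookup_single when_def mon_eq_iff)

lemma var_eq_X: "var i j k = X (i, j, k)"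
  by (simp add: var_def X_def)

lemma prod_list_X: "prod_list (map X ts) = Poly_Mapping.single (mon ts) 1"
  by (induction ts) (auto simp: mon_def X_def mult_single)

lemma single_mon: "Poly_Mapping.single (mon ts) c = const c * prod_list (map X ts)"
  by (simp add: prod_list_X const_def mult_single)

lemma subst_X: "subst s (X t) = s t"
  by (cases t) (simp flip: var_eq_X)

lemma subst_monomial:
  "subst s (Poly_Mapping.single (mon ts) c) = const c * prod_list (map s ts)"
proof -
  have "subst s 1 = 1" using subst_const[of s 1] by simp
  moreover have "subst s (X t) = s t" for t
    by (cases t) (simp flip: var_eq_X)
  ultimately have "subst s (prod_list (map X ts)) = prod_list (map s ts)"
    by (induction ts) (simp_all add: subst_mult)
  then show ?thesis by (simp add: single_mon subst_mult)
qed

lemma subst_subst: "subst s (subst s' f) = subst (\<lambda>v. subst s (s' v)) f"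
proof (induction f rule: array_poly_induct)
  case (plus m c g)
  obtain us where "m = mon us" by (rule mon_surj)
  moreover have "subst s (prod_list (map s' us)) = prod_list (map (\<lambda>v. subst s (s' v)) us)"
    using subst_const[of s 1] by (induction us) (simp_all add: subst_mult)
  ultimately show ?case
    using plus by (simp add: subst_add subst_monomial subst_mult)
qed simp

lemma subst_sum: "subst s (sum g I) = (\<Sum>i\<in>I. subst s (g i))"
  by (induction I rule: infinite_finite_induct) (simp_all add: subst_add)

text \<open>
  The degree of a monomial is the length of any list of positions that represents it.
\<close>

lemma homogeneous_iff:
  "homogeneous_of_degree d f \<longleftrightarrow> (\<forall>ts. coef f ts \<noteq> 0 \<longrightarrow> length ts = d)"
proof -
  have *: "(\<Sum>v\<in>UNIV. Poly_Mapping.lookup (mon ts) v) = length ts" for ts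
    using sum_count_set[of ts UNIV] by (simp add: lookup_mon)
  show ?thesis
    unfolding homogeneous_of_degree_def coef_def
    by (metis * in_keys_iff mon_surj)
qed

lemma prod_list_map_remove1:
  "x \<in> set xs \<Longrightarrow> prod_list (map g xs) = g x * prod_list (map g (remove1 x xs))"
  for g :: "'a \<Rightarrow> 'b :: comm_monoid_mult"
  by (induction xs) (auto simp: mult_ac)

lemma count_list_map_inj: "inj g \<Longrightarrow> count_list (map g xs) (g x) = count_list xs x"
  by (induction xs) (auto simp: inj_eq)

lemma remove1_map_inj: "inj g \<Longrightarrow> remove1 (g x) (map g xs) = map g (remove1 x xs)"
  by (induction xs) (auto simp: inj_eq)

section \<open>Consequences of invariance under monomial matrices\<close>

text \<open>
  A substitution that sends each variable to a multiple of a variable permutes the monomials, so it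
  changes coefficients only by the product of the multipliers.
\<close>

lemma coef_subst_relabel:
  assumes "inj \<pi>"
  shows "coef (subst (\<lambda>v. const (l v) * X (\<pi> v)) f) (map \<pi> ts) = prod_list (map l ts) * coef f ts"
proof (induction f rule: array_poly_induct)
  case zero
  show ?case by simp
next
  case (plus m c g)
  obtain us where m: "m = mon us" by (rule mon_surj)
  have "prod_list (map (\<lambda>v. const (l v) * X (\<pi> v)) us)
      = const (prod_list (map l us)) * Poly_Mapping.single (mon (map \<pi> us)) 1"
    unfolding prod_list_X[symmetric]
    by (induction us) (simp_all add: const_mult mult_ac)
  then have *: "coef (subst (\<lambda>v. const (l v) * X (\<pi> v)) (Poly_Mapping.single m c)) (map \<pi> ts)
      = (if mset (map \<pi> us) = mset (map \<pi> ts) then c * prod_list (map l us) else 0)"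
    by (simp add: m subst_monomial coef_const_mult coef_single)
  have inj: "mset (map \<pi> us) = mset (map \<pi> ts) \<longleftrightarrow> mset us = mset ts"
    using multiset.inj_map[OF assms] by (simp add: inj_eq)
  have "prod_list (map l us) = prod_list (map l ts)" if "mset us = mset ts"
    using that by (metis mset_map prod_mset_prod_list)
  then show ?case
    unfolding subst_add coef_add * inj plus.IH
    by (auto simp: m coef_single distrib_left)
qed

lemma mat_1_entry: "(mat 1 :: complex^3^3) $ i $ j = (if i = j then 1 else 0)"
  by (simp add: mat_def)

lemma act_first:
  "act A (mat 1) (mat 1) = subst (\<lambda>(i, j, k). \<Sum>p\<in>UNIV. const (A $ p $ i) * X (p, j, k))"
proof -
  have "(\<Sum>q\<in>UNIV. \<Sum>r\<in>UNIV. const (A $ p $ i * mat 1 $ q $ j * mat 1 $ r $ k) * var p q r)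
     = const (A $ p $ i) * X (p, j, k)" for p i j k
  proof -
    have "(\<Sum>q\<in>UNIV. \<Sum>r\<in>UNIV. const (A $ p $ i * mat 1 $ q $ j * mat 1 $ r $ k) * var p q r)
     = (\<Sum>q\<in>UNIV. \<Sum>r\<in>UNIV. if r = k then (if q = j then const (A $ p $ i) * var p q r else 0) else 0)"
      by (intro sum.cong refl) (auto simp: mat_1_entry)
    then show ?thesis by (simp add: var_eq_X)
  qed
  then show ?thesis by (simp add: act_def)
qed

text \<open>
  Diagonal matrices and multiples of permutation matrices are both covered by this form.
\<close>

lemma invariant_relabel:
  assumes f: "SL3_invariant f" and \<sigma>: "bij \<sigma>"
    and det: "det (\<chi> p i. if p = \<sigma> i then l i else 0) = (1::complex)"
  shows "coef f (map (\<lambda>(i, j, k). (\<sigma> i, j, k)) ts) = prod_list (map (l \<circ> fst) ts) * coef f ts"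
proof -
  let ?A = "\<chi> p i. if p = \<sigma> i then l i else 0"
  let ?\<pi> = "\<lambda>(i, j, k). (\<sigma> i, j, k) :: position"
  have "(\<Sum>p\<in>UNIV. const (?A $ p $ i) * X (p, j, k)) = const (l i) * X (\<sigma> i, j, k)" for i j k
  proof -
    have "(\<Sum>p\<in>UNIV. const (?A $ p $ i) * X (p, j, k))
        = (\<Sum>p\<in>UNIV. if p = \<sigma> i then const (l i) * X (p, j, k) else 0)"
      by (rule sum.cong) auto
    then show ?thesis by simp
  qed
  then have "act ?A (mat 1) (mat 1) f = subst (\<lambda>v. const ((l \<circ> fst) v) * X (?\<pi> v)) f"
    unfolding act_first by (intro arg_cong[of _ _ "\<lambda>s. subst s f"] ext) auto
  moreover have "act ?A (mat 1) (mat 1) f = f"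
    using f det by (simp add: SL3_invariant_def)
  moreover have "inj ?\<pi>"
    using \<sigma> by (auto simp: inj_on_def bij_def)
  ultimately show ?thesis
    using coef_subst_relabel[of ?\<pi> "l \<circ> fst" f ts] by simp
qed

definition invariant9 :: "array_poly \<Rightarrow> bool" where
  "invariant9 f \<longleftrightarrow> homogeneous_of_degree 9 f \<and> SL3_invariant f"

text \<open>
  A permutation matrix of sign \<open>s\<close> has determinant \<open>s\<close>, and multiplied by \<open>s\<close> it has determinant
  \<open>s ^ 4 = 1\<close>.  The multiplier contributes \<open>s ^ 9 = s\<close> to a monomial of degree 9.
\<close>

lemma coef_permute_first:
  assumes f: "invariant9 f" and \<sigma>: "\<sigma> permutes (UNIV :: 3 set)"
  shows "coef f (map (\<lambda>(i, j, k). (\<sigma> i, j, k)) ts) = of_int (sign \<sigma>) * coef f ts"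
proof (cases "length ts = 9")
  case True
  let ?l = "of_int (sign \<sigma>) :: complex"
  have "(\<chi> p i. if p = \<sigma> i then ?l else 0) = (\<chi> p i. (mat ?l :: complex^3^3) $ p $ \<sigma> i)"
    by (simp add: mat_def vec_eq_iff)
  then have "det (\<chi> p i. if p = \<sigma> i then ?l else 0) = ?l * det (mat ?l :: complex^3^3)"
    using det_permute_columns[OF \<sigma>, of "mat ?l"] by simp
  also have "det (mat ?l :: complex^3^3) = ?l ^ 3"
    by (subst det_diagonal) (auto simp: mat_def)
  also have "?l * ?l ^ 3 = 1"
    by (cases "sign \<sigma> = 1") (auto simp: sign_def split: if_splits)
  finally have "coef f (map (\<lambda>(i, j, k). (\<sigma> i, j, k)) ts) = prod_list (map ((\<lambda>_. ?l) \<circ> fst) ts) * coef f ts"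
    by (intro invariant_relabel) (use f \<sigma> in \<open>auto simp: invariant9_def permutes_bij\<close>)
  moreover have "prod_list (map ((\<lambda>_. ?l) \<circ> fst) ts) = ?l ^ 9"
    using True by (simp add: map_replicate_const comp_def)
  moreover have "?l ^ 9 = ?l"
    by (auto simp: sign_def)
  ultimately show ?thesis by simp
next
  case False
  then have "coef f us = 0" if "length us = length ts" for us
    using f that by (auto simp: invariant9_def homogeneous_iff)
  then show ?thesis by simp
qed

definition occurs :: "('a \<Rightarrow> 'b) \<Rightarrow> 'b \<Rightarrow> 'a list \<Rightarrow> nat" where
  "occurs c v ts = length (filter (\<lambda>t. c t = v) ts)"

lemma sum_occurs: "(\<Sum>v\<in>UNIV. occurs c v ts) = length ts" for c :: "'a \<Rightarrow> 'b :: finite"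
proof (induction ts)
  case (Cons t ts)
  have "(\<Sum>v\<in>UNIV. occurs c v (t # ts)) = (\<Sum>v\<in>UNIV. (if v = c t then 1 else 0) + occurs c v ts)"
    by (rule sum.cong) (auto simp: occurs_def)
  then show ?case using Cons by (simp add: sum.distrib)
qed (simp add: occurs_def)

text \<open>
  A torus element with entries 2 and 1/2 scales a monomial by a power of 2 that is trivial only
  if the two values occur equally often.  As the degree is 9, each value then occurs three times.
\<close>

lemma first_balanced:
  assumes f: "invariant9 f" and nz: "coef f ts \<noteq> 0"
  shows "occurs fst a ts = 3"
proof -
  have eq: "occurs fst b ts = occurs fst a ts" for b
  proof (cases "a = b")
    case False
    \<comment> \<open>The torus element with entries 2 at \<open>a\<close> and 1/2 at \<open>b\<close>.\<close>
    define l where "l = (\<lambda>i :: 3. if i = a then 2 else if i = b then 1 / 2 else 1 :: complex)"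
    have "det (\<chi> p i. if p = id i then l i else 0) = prod l UNIV"
      by (subst det_diagonal) auto
    also have "\<dots> = prod l {a, b}"
      by (rule prod.mono_neutral_right) (auto simp: l_def)
    also have "\<dots> = 1"
      using False by (simp add: l_def)
    finally have "coef f (map (\<lambda>(i, j, k). (id i, j, k)) ts) = prod_list (map (l \<circ> fst) ts) * coef f ts"
      by (intro invariant_relabel bij_id) (use f in \<open>auto simp: invariant9_def\<close>)
    moreover have "map (\<lambda>(i, j, k). (id i, j, k)) ts = ts"
      by (simp add: case_prod_beta)
    ultimately have "prod_list (map (l \<circ> fst) ts) = 1" using nz by simp
    moreover have "prod_list (map (l \<circ> fst) ts) * 2 ^ occurs fst b ts = 2 ^ occurs fst a ts"
      using False by (induction ts) (auto simp: l_def occurs_def)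
    ultimately have "(2 :: complex) ^ occurs fst b ts = 2 ^ occurs fst a ts" by simp
    then have "(of_nat (2 ^ occurs fst b ts) :: complex) = of_nat (2 ^ occurs fst a ts)" by simp
    then show ?thesis unfolding of_nat_eq_iff by simp
  qed simp
  have "length ts = 9"
    using f nz by (auto simp: invariant9_def homogeneous_iff)
  moreover have "length ts = 3 * occurs fst a ts"
  proof -
    have "(\<Sum>b\<in>UNIV. occurs fst b ts) = (\<Sum>b\<in>(UNIV :: 3 set). occurs fst a ts)"
      by (rule sum.cong[OF refl eq])
    then show ?thesis by (simp add: sum_occurs)
  qed
  ultimately show ?thesis by simp
qed

section \<open>Interchanging the directions of the array\<close>

definition relabel :: "(position \<Rightarrow> position) \<Rightarrow> array_poly \<Rightarrow> array_poly" where
  "relabel \<pi> = subst (\<lambda>v. X (\<pi> v))"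

lemma coef_relabel: "inj \<pi> \<Longrightarrow> coef (relabel \<pi> f) (map \<pi> ts) = coef f ts"
  using coef_subst_relabel[of \<pi> "\<lambda>_. 1" f ts] by (simp add: relabel_def map_replicate_const)

fun exchange12 :: "'a \<times> 'a \<times> 'a \<Rightarrow> 'a \<times> 'a \<times> 'a" where
  "exchange12 (i, j, k) = (j, i, k)"

fun exchange23 :: "'a \<times> 'a \<times> 'a \<Rightarrow> 'a \<times> 'a \<times> 'a" where
  "exchange23 (i, j, k) = (i, k, j)"

lemma exchange_involution [simp]:
  "exchange12 (exchange12 t) = t" "exchange23 (exchange23 t) = t"
  by (cases t; simp)+

text \<open>
  Interchanging directions normalizes the group that acts: it interchanges two of the three matrices.
  This is what makes the space of invariants stable under it.
\<close>

lemma act_relabel12: "act A B C (relabel exchange12 f) = relabel exchange12 (act B A C f)"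
proof -
  have "act A B C (X (exchange12 v)) = relabel exchange12 (act B A C (X v))" for v
  proof (cases v)
    case (fields i j k)
    have "act A B C (X (exchange12 v)) = (\<Sum>q\<in>UNIV. \<Sum>p\<in>UNIV. \<Sum>r\<in>UNIV.
        const (A $ q $ j * B $ p $ i * C $ r $ k) * X (q, p, r))"
      by (simp add: fields act_def subst_X var_eq_X)
    also have "\<dots> = (\<Sum>p\<in>UNIV. \<Sum>q\<in>UNIV. \<Sum>r\<in>UNIV.
        const (B $ p $ i * A $ q $ j * C $ r $ k) * X (q, p, r))"
      by (subst sum.swap) (simp add: mult_ac)
    also have "\<dots> = relabel exchange12 (act B A C (X v))"
      by (simp add: fields act_def subst_X relabel_def subst_sum subst_mult var_eq_X)
    finally show ?thesis .
  qed
  then show ?thesis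
    by (simp add: act_def relabel_def subst_subst subst_X)
qed

lemma act_relabel23: "act A B C (relabel exchange23 f) = relabel exchange23 (act A C B f)"
proof -
  have "act A B C (X (exchange23 v)) = relabel exchange23 (act A C B (X v))" for v
  proof (cases v)
    case (fields i j k)
    have "act A B C (X (exchange23 v)) = (\<Sum>p\<in>UNIV. \<Sum>r\<in>UNIV. \<Sum>q\<in>UNIV.
        const (A $ p $ i * B $ r $ k * C $ q $ j) * X (p, r, q))"
      by (simp add: fields act_def subst_X var_eq_X)
    also have "\<dots> = (\<Sum>p\<in>UNIV. \<Sum>q\<in>UNIV. \<Sum>r\<in>UNIV.
        const (A $ p $ i * C $ q $ j * B $ r $ k) * X (p, r, q))"
      by (rule sum.cong[OF refl], subst sum.swap) (simp add: mult_ac)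
    also have "\<dots> = relabel exchange23 (act A C B (X v))"
      by (simp add: fields act_def subst_X relabel_def subst_sum subst_mult var_eq_X)
    finally show ?thesis .
  qed
  then show ?thesis
    by (simp add: act_def relabel_def subst_subst subst_X)
qed

lemma invariant9_relabel:
  assumes f: "invariant9 f" and "\<pi> = exchange12 \<or> \<pi> = exchange23"
  shows "invariant9 (relabel \<pi> f)"
proof -
  have inv: "\<pi> (\<pi> t) = t" for t using assms(2) by auto
  then have "inj \<pi>" by (metis injI)
  have "coef (relabel \<pi> f) ts = coef f (map \<pi> ts)" for ts
    using coef_relabel[OF \<open>inj \<pi>\<close>, of f "map \<pi> ts"] by (simp add: inv comp_def)
  then have "homogeneous_of_degree 9 (relabel \<pi> f)"
    using f by (auto simp: invariant9_def homogeneous_iff)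
  moreover have "SL3_invariant (relabel \<pi> f)"
    using f assms(2) by (auto simp: invariant9_def SL3_invariant_def act_relabel12 act_relabel23)
  ultimately show ?thesis by (simp add: invariant9_def)
qed

lemma coef_relabel_exchange:
  assumes "\<pi> = exchange12 \<or> \<pi> = exchange23"
  shows "coef (relabel \<pi> f) ts = coef f (map \<pi> ts)"
proof -
  have inv: "\<pi> (\<pi> t) = t" for t using assms by auto
  then have "inj \<pi>" by (metis injI)
  then show ?thesis
    using coef_relabel[of \<pi> f "map \<pi> ts"] by (simp add: inv comp_def)
qed

section \<open>The raising operator\<close>

text \<open>
  A polynomial function of \<open>t\<close> that is constant has no linear term; here \<open>p\<close> is a polynomial in \<open>t\<close>
  whose coefficients are polynomials in the entries of the array.
\<close>

lemma coef_evaluation_constant: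
  assumes "\<And>t. coef (poly p (const t)) ts = k"
  shows "coef (coeff p 1) ts = 0"
proof -
  define q where "q = map_poly (\<lambda>c. coef c ts) p"
  have "poly q t = coef (poly p (const t)) ts" for t
    unfolding q_def
  proof (induction p)
    case (pCons a p)
    then show ?case
      by (cases "pCons a p = 0") (auto simp: map_poly_pCons coef_add coef_const_mult)
  qed simp
  then have "q = [:k:]"
    by (intro poly_eqI_degree poly_ext) (simp add: assms)
  then have "coeff q 1 = 0" by simp
  then show ?thesis by (simp add: q_def coeff_map_poly)
qed

text \<open>
  The product rule: the linear term of a product of factors \<open>X v + t D v\<close> is the derivative of the
  monomial in the direction \<open>D\<close>.
\<close>

lemma coeff_prod_linear:
  "coeff (prod_list (map (\<lambda>v. [:X v, D v:]) us)) 0 = prod_list (map X us)"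
  "coeff (prod_list (map (\<lambda>v. [:X v, D v:]) us)) 1
    = (\<Sum>v\<in>UNIV. const (of_nat (count_list us v)) * (D v * prod_list (map X (remove1 v us))))"
proof (induction us)
  case Nil
  {
    case 1 show ?case by simp
  next
    case 2 show ?case by simp
  }
next
  case (Cons u us)
  {
    case 1
    show ?case using Cons by simp
  next
    case 2
    have split: "const (of_nat (count_list (u # us) v)) * (D v * prod_list (map X (remove1 v (u # us))))
        = (if v = u then D u * prod_list (map X us) else 0)
          + X u * (const (of_nat (count_list us v)) * (D v * prod_list (map X (remove1 v us))))" for v
    proof (cases "v = u \<and> u \<in> set us")
      case True
      then have "prod_list (map X us) = X u * prod_list (map X (remove1 u us))"
        by (intro prod_list_map_remove1) simp
      then show ?thesis using True by (simp add: const_add algebra_simps)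
    next
      case False
      then show ?thesis by (auto simp: mult_ac)
    qed
    have "coeff (prod_list (map (\<lambda>v. [:X v, D v:]) (u # us))) 1
       = D u * prod_list (map X us) + X u * coeff (prod_list (map (\<lambda>v. [:X v, D v:]) us)) 1"
      using Cons(1) by simp
    then show ?case
      unfolding split Cons(2) by (simp add: sum.distrib sum_distrib_left)
  }
qed

text \<open>
  The substitution performed by \<open>1 + t E\<close> acting on the first index, where \<open>E\<close> is the matrix unit
  that sends the value 2 to the value 1.
\<close>

definition raise :: "complex \<Rightarrow> position \<Rightarrow> array_poly" where
  "raise t v = X v + const t * (if fst v = 2 then X (1, snd v) else 0)"

lemma act_raise:
  fixes t :: complex
  defines "A \<equiv> \<chi> p i. if p = i then 1 else if p = 1 \<and> i = 2 then t else 0"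
  shows "act A (mat 1) (mat 1) = subst (raise t)" and "det A = 1"
proof -
  show "det A = 1"
    by (simp add: A_def det_3)
  have "(\<Sum>p\<in>UNIV. const (A $ p $ i) * X (p, j, k)) = raise t (i, j, k)" for i j k
    using exhaust_3[of i] by (auto simp: sum_3 A_def raise_def)
  then show "act A (mat 1) (mat 1) = subst (raise t)"
    unfolding act_first by (intro arg_cong[of _ _ subst] ext) auto
qed

text \<open>
  The coefficient at \<open>ns\<close> of the derivative of \<open>f\<close>.  The monomial \<open>ns\<close> arises from the monomials in
  which one of its factors with first index 1 is replaced by the one with first index 2; the
  multiplicity of the latter is the exponent that differentiation brings down.
\<close>

definition raising_sum :: "array_poly \<Rightarrow> position list \<Rightarrow> complex" where
  "raising_sum f ns = (\<Sum>p\<in>UNIV. if (1, p) \<in> set ns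
     then of_nat (1 + count_list ns (2, p)) * coef f ((2, p) # remove1 (1, p) ns) else 0)"

text \<open>
  The transformed polynomial depends polynomially on \<open>t\<close>.  The linear coefficient is known for monomials
  by the product rule, hence for all polynomials.
\<close>

lemma raise_expansion:
  "\<exists>P. (\<forall>t. poly P (const t) = subst (raise t) f) \<and> (\<forall>ns. coef (coeff P 1) ns = raising_sum f ns)"
proof (induction f rule: array_poly_induct)
  case zero
  show ?case by (intro exI[of _ 0]) (simp add: raising_sum_def cong: if_cong)
next
  case (plus m c g)
  obtain us where m: "m = mon us" by (rule mon_surj)
  obtain P where P: "\<And>t. poly P (const t) = subst (raise t) g"
    "\<And>ns. coef (coeff P 1) ns = raising_sum g ns"
    using plus by auto
  \<comment> \<open>\<open>Q\<close> is the image of the monomial under \<open>X v \<mapsto> X v + t D v\<close>, with \<open>t\<close> an indeterminate.\<close>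
  define D where "D = (\<lambda>v. if fst v = (2 :: 3) then X (1, snd v) else 0)"
  define Q where "Q = smult (const c) (prod_list (map (\<lambda>v. [:X v, D v:]) us))"
  have "poly (prod_list (map (\<lambda>v. [:X v, D v:]) us)) (const t) = prod_list (map (raise t) us)" for t
    by (induction us) (simp_all add: raise_def D_def algebra_simps)
  then have Q: "poly Q (const t) = subst (raise t) (Poly_Mapping.single m c)" for t
    by (simp add: Q_def m subst_monomial)
  have "coef (coeff Q 1) ns = raising_sum (Poly_Mapping.single m c) ns" for ns
  proof -
    have summand: "coef (const (of_nat (count_list us (2, p))) * (D (2, p) * prod_list (map X (remove1 (2, p) us)))) ns
      = (if (1, p) \<in> set ns then of_nat (1 + count_list ns (2, p)) *
          (if mset us = mset ((2, p) # remove1 (1, p) ns) then 1 else 0) else 0)" for p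
    proof -
      let ?a = "(1, p) :: position" and ?b = "(2, p) :: position"
      have "D ?b * prod_list (map X (remove1 ?b us)) = Poly_Mapping.single (mon (?a # remove1 ?b us)) 1"
        using prod_list_X[of "?a # remove1 ?b us"] by (simp add: D_def)
      then have *: "coef (const (of_nat (count_list us ?b)) * (D ?b * prod_list (map X (remove1 ?b us)))) ns
        = of_nat (count_list us ?b) * (if mset (?a # remove1 ?b us) = mset ns then 1 else 0)"
        by (simp only: coef_const_mult coef_single)
      show ?thesis
      proof (cases "?b \<in> set us")
        case True
        \<comment> \<open>Changing \<open>(2, p)\<close> to \<open>(1, p)\<close> in \<open>us\<close> gives \<open>ns\<close> if and only if the reverse change takes \<open>ns\<close> to \<open>us\<close>.\<close>
        have "mset (?a # remove1 ?b us) = mset ns \<longleftrightarrow>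
            ?a \<in> set ns \<and> mset us = mset (?b # remove1 ?a ns)"
        proof -
          have us: "mset us = add_mset ?b (mset us - {#?b#})"
            using True by simp
          have "add_mset ?a (mset us - {#?b#}) = mset ns \<longleftrightarrow>
             ?a \<in># mset ns \<and> mset us - {#?b#} = mset ns - {#?a#}"
            by (metis add_mset_remove_trivial insert_DiffM union_single_eq_member add_mset_add_single union_commute)
          then show ?thesis
            using us by (metis add_mset_remove_trivial mset.simps(2) mset_remove1 set_mset_mset)
        qed
        moreover have "count_list us ?b = 1 + count_list ns ?b" if "mset us = mset (?b # remove1 ?a ns)"
        proof -
          have "count (mset us) ?b = 1 + count (mset ns) ?b" unfolding that by simp
          then show ?thesis by (simp add: count_mset)
        qed
        ultimately show ?thesis unfolding * by auto
      next
        case False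
        then have "mset us \<noteq> mset (?b # remove1 ?a ns)"
          by (metis list.set_intros(1) mset_eq_setD)
        moreover have "count_list us ?b = 0" using False by simp
        ultimately show ?thesis unfolding * by simp
      qed
    qed
    have "coeff Q 1 = const c * (\<Sum>v\<in>UNIV. const (of_nat (count_list us v)) * (D v * prod_list (map X (remove1 v us))))"
      unfolding Q_def coeff_smult coeff_prod_linear ..
    also have "(\<Sum>v\<in>UNIV. const (of_nat (count_list us v)) * (D v * prod_list (map X (remove1 v us))))
        = (\<Sum>i\<in>UNIV. \<Sum>p\<in>UNIV. const (of_nat (count_list us (i, p))) * (D (i, p) * prod_list (map X (remove1 (i, p) us))))"
      unfolding sum.cartesian_product UNIV_Times_UNIV by (rule sum.cong) auto
    also have "\<dots> = (\<Sum>p\<in>UNIV. const (of_nat (count_list us (2, p))) * (D (2, p) * prod_list (map X (remove1 (2, p) us))))"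
      by (simp add: sum_3 D_def)
    finally have "coef (coeff Q 1) ns = c * (\<Sum>p\<in>UNIV. coef
        (const (of_nat (count_list us (2, p))) * (D (2, p) * prod_list (map X (remove1 (2, p) us)))) ns)"
      by (simp only: coef_const_mult coef_sum)
    then show ?thesis
      unfolding summand raising_sum_def m coef_single sum_distrib_left by (auto intro!: sum.cong)
  qed
  with P Q show ?case
    by (intro exI[of _ "Q + P"])
      (auto simp: subst_add coef_add raising_sum_def sum.distrib[symmetric] distrib_left intro!: sum.cong)
qed

lemma raising_relation:
  assumes "SL3_invariant f"
  shows "raising_sum f ns = 0"
proof -
  obtain P where P: "\<And>t. poly P (const t) = subst (raise t) f"
    "\<And>ns. coef (coeff P 1) ns = raising_sum f ns"
    using raise_expansion by blast
  have "subst (raise t) f = f" for t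
    unfolding act_raise(1)[symmetric]
    using assms act_raise(2)[of t] by (simp add: SL3_invariant_def)
  then have "coef (coeff P 1) ns = 0"
    by (intro coef_evaluation_constant) (simp add: P)
  then show ?thesis unfolding P(2) .
qed

section \<open>Cells and the generators of the symmetry group\<close>

text \<open>
  A copy of the index set on which evaluation by rewriting is cheap; the map \<open>point\<close> below identifies
  it with the original one.
\<close>

datatype idx = I1 | I2 | I3

type_synonym cell = "idx \<times> idx \<times> idx"

fun swap12 :: "idx \<Rightarrow> idx" where
  "swap12 I1 = I2" | "swap12 I2 = I1" | "swap12 I3 = I3"

fun swap13 :: "idx \<Rightarrow> idx" where
  "swap13 I1 = I3" | "swap13 I2 = I2" | "swap13 I3 = I1"

fun swap23 :: "idx \<Rightarrow> idx" where
  "swap23 I1 = I1" | "swap23 I2 = I3" | "swap23 I3 = I2"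

text \<open>
  The transpositions of two values of the first, second or third index (\<open>X\<close>, \<open>Y\<close>, \<open>Z\<close>) and of two
  directions (\<open>D\<close>).  They generate \<open>G\<close>, and each of them is an odd element of \<open>G\<close>.
\<close>

datatype generator = X12 | X13 | X23 | Y12 | Y13 | Y23 | Z12 | Z13 | Z23 | D12 | D13 | D23

fun move :: "generator \<Rightarrow> cell \<Rightarrow> cell" where
  "move X12 (i, j, k) = (swap12 i, j, k)"
| "move X13 (i, j, k) = (swap13 i, j, k)"
| "move X23 (i, j, k) = (swap23 i, j, k)"
| "move Y12 (i, j, k) = (i, swap12 j, k)"
| "move Y13 (i, j, k) = (i, swap13 j, k)"
| "move Y23 (i, j, k) = (i, swap23 j, k)"
| "move Z12 (i, j, k) = (i, j, swap12 k)"
| "move Z13 (i, j, k) = (i, j, swap13 k)"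
| "move Z23 (i, j, k) = (i, j, swap23 k)"
| "move D12 (i, j, k) = (j, i, k)"
| "move D13 (i, j, k) = (k, j, i)"
| "move D23 (i, j, k) = (i, k, j)"

definition transform :: "generator list \<Rightarrow> cell list \<Rightarrow> cell list" where
  "transform w ts = map (fold move w) ts"

definition parity :: "generator list \<Rightarrow> int" where
  "parity w = (if even (length w) then 1 else - 1)"

definition value_swaps :: "generator list" where
  "value_swaps = [X12, X13, X23, Y12, Y13, Y23, Z12, Z13, Z23]"

text \<open>
  Equality of multisets in a form that rewriting evaluates directly, see \<open>same_iff\<close>.
\<close>

fun same :: "'a list \<Rightarrow> 'a list \<Rightarrow> bool" where
  "same [] ys \<longleftrightarrow> ys = []"
| "same (x # xs) ys \<longleftrightarrow> x \<in> set ys \<and> same xs (remove1 x ys)"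

lemma same_iff: "same xs ys \<longleftrightarrow> mset xs = mset ys"
proof (induction xs arbitrary: ys)
  case (Cons x xs)
  then show ?case
    by (auto simp: in_multiset_in_set) (metis insert_DiffM add_mset_remove_trivial set_mset_mset union_single_eq_member)+
qed auto

fun point :: "idx \<Rightarrow> 3" where
  "point I1 = 1" | "point I2 = 2" | "point I3 = 3"

lemma point_eq_iff [simp]: "point i = point j \<longleftrightarrow> i = j"
  by (cases i; cases j) simp_all

lemma point_surj: "\<exists>i. point i = a"
  using exhaust_3[of a] by (metis point.simps)

definition place :: "cell \<Rightarrow> position" where
  "place = map_prod point (map_prod point point)"

lemma inj_place: "inj place"
  unfolding place_def by (intro prod.inj_map) (auto simp: inj_on_def)

definition cell_coef :: "array_poly \<Rightarrow> cell list \<Rightarrow> complex" where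
  "cell_coef f ts = coef f (map place ts)"

lemma cell_coef_cong: "mset ts = mset us \<Longrightarrow> cell_coef f ts = cell_coef f us"
  unfolding cell_coef_def by (rule coef_cong) simp

lemma transform_Cons: "transform (g # w) ts = transform w (map (move g) ts)"
  by (simp add: transform_def)

lemma transform_append: "transform (v @ w) ts = transform w (transform v ts)"
  by (simp add: transform_def)

lemma transform_Nil [simp]: "transform [] ts = ts"
  by (simp add: transform_def)

lemma mset_transform: "mset (transform w ts) = image_mset (fold move w) (mset ts)"
  by (simp add: transform_def)

lemma mset_transform_cong: "mset ts = mset us \<Longrightarrow> mset (transform w ts) = mset (transform w us)"
  by (simp add: mset_transform)

lemma parity_Cons: "parity (g # w) = - parity w"
  by (simp add: parity_def)

lemma parity_square [simp]: "parity w * parity w = 1" "parity w * (parity w * q) = q"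
  by (auto simp: parity_def)

lemma move_involution [simp]: "move g (move g t) = t"
proof -
  have "swap12 (swap12 i) = i" "swap13 (swap13 i) = i" "swap23 (swap23 i) = i" for i
    by (cases i; simp)+
  then show ?thesis by (cases t; cases g) simp_all
qed

lemma cell_coef_exchange:
  "cell_coef f (map exchange12 ts) = cell_coef (relabel exchange12 f) ts"
  "cell_coef f (map exchange23 ts) = cell_coef (relabel exchange23 f) ts"
proof -
  have "place \<circ> exchange12 = exchange12 \<circ> place" "place \<circ> exchange23 = exchange23 \<circ> place"
    by (auto simp: place_def)
  then show "cell_coef f (map exchange12 ts) = cell_coef (relabel exchange12 f) ts"
    "cell_coef f (map exchange23 ts) = cell_coef (relabel exchange23 f) ts"
    by (simp_all add: cell_coef_def coef_relabel_exchange)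
qed

lemma exchanged_invariant:
  fixes e :: "cell \<Rightarrow> cell"
  assumes f: "invariant9 f" and e: "e = exchange12 \<or> e = exchange23"
  obtains f' where "invariant9 f'" "\<And>ts. cell_coef f (map e ts) = cell_coef f' ts"
proof (cases "e = exchange12")
  case True
  with that[of "relabel exchange12 f"] show ?thesis
    using invariant9_relabel[OF f] cell_coef_exchange(1) by blast
next
  case False
  with e that[of "relabel exchange23 f"] show ?thesis
    using invariant9_relabel[OF f] cell_coef_exchange(2) by blast
qed

definition alternating :: "(cell \<Rightarrow> cell) \<Rightarrow> bool" where
  "alternating \<pi> \<longleftrightarrow> (\<forall>f ts. invariant9 f \<longrightarrow> cell_coef f (map \<pi> ts) = - cell_coef f ts)"

lemma alternating_first:
  assumes "a \<noteq> b" and "\<And>i. point (s i) = Transposition.transpose a b (point i)"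
  shows "alternating (\<lambda>(i, j, k). (s i, j, k))"
  unfolding alternating_def
proof (intro allI impI)
  fix f ts assume f: "invariant9 f"
  have eq: "map place (map (\<lambda>(i, j, k). (s i, j, k)) ts)
      = map (\<lambda>(i, j, k). (Transposition.transpose a b i, j, k)) (map place ts)"
    by (simp add: place_def assms(2) case_prod_beta)
  have sgn: "sign (Transposition.transpose a b) = - 1"
    using assms(1) by (simp add: sign_swap_id)
  have "cell_coef f (map (\<lambda>(i, j, k). (s i, j, k)) ts) = of_int (sign (Transposition.transpose a b)) * cell_coef f ts"
    unfolding cell_coef_def eq by (rule coef_permute_first[OF f permutes_swap_id]) auto
  then show "cell_coef f (map (\<lambda>(i, j, k). (s i, j, k)) ts) = - cell_coef f ts"
    unfolding sgn by simp
qed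

text \<open>
  The space of invariants is stable under interchanging directions, so a statement about the first
  index that holds for all invariants holds for the other two indices as well.
\<close>

lemma alternating_conjugate:
  assumes "alternating \<pi>" and "e = exchange12 \<or> e = exchange23"
  shows "alternating (e \<circ> \<pi> \<circ> e)"
  unfolding alternating_def
proof (intro allI impI)
  fix f ts assume f: "invariant9 f"
  obtain f' where f': "invariant9 f'" and *: "cell_coef f (map e us) = cell_coef f' us" for us
    using exchanged_invariant[OF f assms(2)] by metis
  have ee: "e (e t) = t" for t using assms(2) by auto
  have "cell_coef f (map (e \<circ> \<pi> \<circ> e) ts) = cell_coef f' (map \<pi> (map e ts))"
    using *[of "map \<pi> (map e ts)"] by (simp add: comp_assoc)
  also have "\<dots> = - cell_coef f' (map e ts)"
    using assms(1) f' unfolding alternating_def by blast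
  also have "cell_coef f' (map e ts) = cell_coef f ts"
    unfolding *[symmetric] by (simp add: ee comp_def)
  finally show "cell_coef f (map (e \<circ> \<pi> \<circ> e) ts) = - cell_coef f ts" .
qed

lemma alternating_value_swap:
  assumes "g \<in> set value_swaps"
  shows "alternating (move g)"
proof -
  have s: "point (swap12 i) = Transposition.transpose 1 2 (point i)" "point (swap13 i) = Transposition.transpose 1 3 (point i)"
    "point (swap23 i) = Transposition.transpose 2 3 (point i)" for i
    by (cases i; simp add: Transposition.transpose_def)+
  have X: "move X12 = (\<lambda>(i, j, k). (swap12 i, j, k))" "move X13 = (\<lambda>(i, j, k). (swap13 i, j, k))"
    "move X23 = (\<lambda>(i, j, k). (swap23 i, j, k))"
    by auto
  have Y: "move Y12 = exchange12 \<circ> move X12 \<circ> exchange12" "move Y13 = exchange12 \<circ> move X13 \<circ> exchange12"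
    "move Y23 = exchange12 \<circ> move X23 \<circ> exchange12"
    by auto
  have Z: "move Z12 = exchange23 \<circ> move Y12 \<circ> exchange23" "move Z13 = exchange23 \<circ> move Y13 \<circ> exchange23"
    "move Z23 = exchange23 \<circ> move Y23 \<circ> exchange23"
    by auto
  have altX: "alternating (move X12)" "alternating (move X13)" "alternating (move X23)"
    unfolding X by (rule alternating_first[OF _ s(1)] alternating_first[OF _ s(2)] alternating_first[OF _ s(3)]; simp)+
  then have altY: "alternating (move Y12)" "alternating (move Y13)" "alternating (move Y23)"
    unfolding Y by (auto intro: alternating_conjugate)
  then have altZ: "alternating (move Z12)" "alternating (move Z13)" "alternating (move Z23)"
    unfolding Z by (auto intro: alternating_conjugate)
  show ?thesis
    using assms altX altY altZ by (auto simp: value_swaps_def)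
qed

lemma cell_coef_transform:
  assumes "invariant9 f" "list_all (\<lambda>g. g \<in> set value_swaps) w"
  shows "cell_coef f (transform w ts) = of_int (parity w) * cell_coef f ts"
  using assms(2)
proof (induction w arbitrary: ts)
  case (Cons g w)
  then show ?case
    using alternating_value_swap[of g] assms(1)
    by (simp add: transform_Cons parity_Cons alternating_def)
qed (simp add: parity_def)

section \<open>Coefficients that are determined by a single one\<close>

text \<open>
  The fourteen monomials of the theorem, in the same order.
\<close>

definition leading_lists :: "cell list list" where
  "leading_lists =
    [[(I1, I2, I3), (I1, I3, I2), (I1, I3, I3), (I2, I1, I3), (I2, I2, I1), (I2, I3, I2),
      (I3, I1, I1), (I3, I1, I1), (I3, I2, I2)],
     [(I1, I2, I3), (I1, I3, I2), (I1, I3, I3), (I2, I1, I3), (I2, I2, I1), (I2, I3, I1),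
       (I3, I1, I2), (I3, I1, I2), (I3, I2, I1)],
     [(I1, I2, I3), (I1, I3, I2), (I1, I3, I3), (I2, I1, I3), (I2, I2, I1), (I2, I2, I2),
       (I3, I1, I1), (I3, I1, I2), (I3, I3, I1)],
     [(I1, I2, I3), (I1, I3, I2), (I1, I3, I3), (I2, I1, I3), (I2, I2, I1), (I2, I2, I1),
       (I3, I1, I1), (I3, I1, I2), (I3, I3, I2)],
     [(I1, I2, I3), (I1, I3, I2), (I1, I3, I3), (I2, I1, I2), (I2, I2, I3), (I2, I3, I1),
       (I3, I1, I1), (I3, I1, I2), (I3, I2, I1)],
     [(I1, I2, I3), (I1, I3, I2), (I1, I3, I3), (I2, I1, I2), (I2, I2, I2), (I2, I3, I1),
       (I3, I1, I1), (I3, I1, I1), (I3, I2, I3)],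
     [(I1, I2, I3), (I1, I3, I2), (I1, I3, I3), (I2, I1, I2), (I2, I2, I1), (I2, I3, I2),
       (I3, I1, I1), (I3, I1, I3), (I3, I2, I1)],
     [(I1, I2, I3), (I1, I3, I2), (I1, I3, I3), (I2, I1, I2), (I2, I2, I1), (I2, I3, I1),
       (I3, I1, I1), (I3, I1, I3), (I3, I2, I2)],
     [(I1, I2, I3), (I1, I3, I2), (I1, I3, I3), (I2, I1, I2), (I2, I1, I3), (I2, I2, I1),
       (I3, I1, I2), (I3, I2, I1), (I3, I3, I1)],
     [(I1, I2, I3), (I1, I3, I2), (I1, I3, I3), (I2, I1, I2), (I2, I1, I2), (I2, I3, I1),
       (I3, I1, I3), (I3, I2, I1), (I3, I2, I1)],
     [(I1, I2, I3), (I1, I3, I2), (I1, I3, I3), (I2, I1, I1), (I2, I1, I2), (I2, I3, I2),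
       (I3, I1, I1), (I3, I2, I1), (I3, I2, I3)],
     [(I1, I2, I3), (I1, I3, I2), (I1, I3, I2), (I2, I1, I3), (I2, I2, I1), (I2, I3, I1),
       (I3, I1, I1), (I3, I1, I2), (I3, I2, I3)],
     [(I1, I2, I3), (I1, I3, I2), (I1, I3, I2), (I2, I1, I3), (I2, I2, I1), (I2, I2, I2),
       (I3, I1, I1), (I3, I1, I1), (I3, I3, I3)],
     [(I1, I2, I3), (I1, I3, I2), (I1, I3, I2), (I2, I1, I3), (I2, I1, I3), (I2, I3, I1),
       (I3, I1, I2), (I3, I2, I1), (I3, I2, I1)]]"

text \<open>
  The reference monomial \<open>m\<close>.  The cells 123, 231, 312 have exponent 1 and the cells 132, 213, 321
  have exponent 2, so interchanging two directions has the same effect on it as interchanging the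
  values 1 and 2 of all three indices, which is an odd symmetry.
\<close>

definition base_list :: "cell list" where
  "base_list = leading_lists ! 13"

text \<open>
  The quantifier over all invariants is inside the definition, so that such a statement can be applied
  to the images of an invariant under interchanges of directions.
\<close>

definition determined :: "cell list \<Rightarrow> int \<Rightarrow> bool" where
  "determined ts q \<longleftrightarrow> (\<forall>f. invariant9 f \<longrightarrow> cell_coef f ts = of_int q * cell_coef f base_list)"

lemma determined_cong: "mset ts = mset us \<Longrightarrow> determined ts q = determined us q"
  unfolding determined_def using cell_coef_cong[of ts us] by simp

text \<open>
  If \<open>e\<close> interchanges two directions, then the coefficient of \<open>f\<close> at the image of \<open>ts\<close> is a coefficient
  at \<open>ts\<close> of another invariant, hence \<open>q\<close> times the coefficient of that invariant at the reference
  monomial, which is the negative of the one of \<open>f\<close>.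
\<close>

lemma determined_exchange:
  assumes "determined ts q" "e = exchange12 \<or> e = exchange23"
  shows "determined (map e ts) (- q)"
  unfolding determined_def
proof (intro allI impI)
  fix f assume f: "invariant9 f"
  obtain f' where f': "invariant9 f'" and *: "cell_coef f (map e us) = cell_coef f' us" for us
    using exchanged_invariant[OF f assms(2)] by metis
  \<comment> \<open>Three odd moves, so the coefficient at the reference monomial changes its sign.\<close>
  have "same (transform [X12, Y12, Z12] base_list) (map exchange12 base_list)"
    "same (transform [X12, Y12, Z12] base_list) (map exchange23 base_list)"
    by code_simp+
  then have "mset (map e base_list) = mset (transform [X12, Y12, Z12] base_list)"
    using assms(2) by (auto simp: same_iff)
  then have "cell_coef f (map e base_list) = cell_coef f (transform [X12, Y12, Z12] base_list)"
    by (rule cell_coef_cong)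
  also have "\<dots> = - cell_coef f base_list"
    using cell_coef_transform[OF f, of "[X12, Y12, Z12]"] by (simp add: value_swaps_def parity_def)
  finally have base: "cell_coef f' base_list = - cell_coef f base_list"
    by (simp add: *)
  show "cell_coef f (map e ts) = of_int (- q) * cell_coef f base_list"
    using assms(1) f' by (simp add: * determined_def base)
qed

lemma determined_move:
  assumes "determined ts q"
  shows "determined (map (move g) ts) (- q)"
proof (cases "g \<in> set value_swaps")
  case True
  then show ?thesis
    using alternating_value_swap[OF True] assms by (simp add: determined_def alternating_def)
next
  case False
  have "move D12 = exchange12" "move D23 = exchange23"
    "move D13 = exchange12 \<circ> exchange23 \<circ> exchange12"
    by auto
  moreover have "determined (map exchange12 (map exchange23 (map exchange12 ts))) (- q)"
    using determined_exchange[OF determined_exchange[OF determined_exchange[OF assms]]] by simp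
  moreover have "g = D12 \<or> g = D13 \<or> g = D23"
    using False by (cases g) (auto simp: value_swaps_def)
  ultimately show ?thesis
    using determined_exchange[OF assms] by (auto simp: comp_assoc)
qed

lemma determined_transform: "determined ts q \<Longrightarrow> determined (transform w ts) (parity w * q)"
proof (induction w arbitrary: ts q)
  case (Cons g w)
  from Cons.IH[OF determined_move[OF Cons.prems]] show ?case
    by (simp add: transform_Cons parity_Cons)
qed (simp add: parity_def)

lemma determined_untransform:
  assumes "determined (transform w ts) q"
  shows "determined ts (parity w * q)"
  using assms
proof (induction w arbitrary: ts q)
  case (Cons g w)
  then have "determined (map (move g) ts) (parity w * q)"
    by (simp add: transform_Cons)
  from determined_move[OF this, of g] show ?case
    by (simp add: parity_Cons comp_def)
qed (simp add: parity_def)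

section \<open>Solving the linear system\<close>

text \<open>
  The terms of the raising relation at \<open>n\<close>, each with its coefficient.
\<close>

definition raised :: "cell list \<Rightarrow> (int \<times> cell list) list" where
  "raised n = map (\<lambda>p. (1 + int (count_list n (I2, p)), (I2, p) # remove1 (I1, p) n))
     (map snd (filter (\<lambda>t. fst t = I1) (remdups n)))"

lemma raised_relation:
  assumes f: "invariant9 f"
  shows "(\<Sum>(c, u)\<leftarrow>raised n. of_int c * cell_coef f u) = 0"
proof -
  let ?pair = "map_prod point point"
  have bij: "bij ?pair"
    using point_surj by (auto simp: bij_def inj_on_def surj_def) metis
  have fin: "finite (UNIV :: (idx \<times> idx) set)"
    using bij_betw_finite[OF bij] by simp
  have place: "(1, ?pair p) = place (I1, p)" "(2, ?pair p) = place (I2, p)" for p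
    by (simp_all add: place_def)
  have "0 = raising_sum f (map place n)"
    using raising_relation[of f] f by (simp add: invariant9_def)
  also have "\<dots> = (\<Sum>p\<in>UNIV. if (1, ?pair p) \<in> set (map place n)
     then of_nat (1 + count_list (map place n) (2, ?pair p)) *
       coef f ((2, ?pair p) # remove1 (1, ?pair p) (map place n)) else 0)"
    unfolding raising_sum_def by (rule sum.reindex_bij_betw[OF bij, symmetric])
  also have "\<dots> = (\<Sum>p\<in>UNIV. if (I1, p) \<in> set n
     then of_nat (1 + count_list n (I2, p)) * cell_coef f ((I2, p) # remove1 (I1, p) n) else 0)"
    unfolding place count_list_map_inj[OF inj_place] remove1_map_inj[OF inj_place] cell_coef_def list.map
    by (simp add: inj_image_mem_iff[OF inj_place])
  also have "\<dots> = (\<Sum>p | (I1, p) \<in> set n. of_nat (1 + count_list n (I2, p)) * cell_coef f ((I2, p) # remove1 (I1, p) n))"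
    unfolding sum.inter_filter[OF fin, symmetric] by simp
  also have "\<dots> = (\<Sum>p\<leftarrow>map snd (filter (\<lambda>t. fst t = I1) (remdups n)).
      of_nat (1 + count_list n (I2, p)) * cell_coef f ((I2, p) # remove1 (I1, p) n))"
  proof -
    let ?ps = "map snd (filter (\<lambda>t. fst t = I1) (remdups n))"
    have "distinct ?ps"
      by (auto simp: distinct_map inj_on_def)
    moreover have "set ?ps = {p. (I1, p) \<in> set n}"
      by force
    ultimately show ?thesis
      by (simp only: sum_list_distinct_conv_sum_set)
  qed
  finally show ?thesis
    by (simp add: raised_def comp_def)
qed

type_synonym table = "(cell list \<times> int) list"

definition entry :: "table \<Rightarrow> cell list \<Rightarrow> int option" where
  "entry tab ts = map_option snd (find (\<lambda>(r, q). same ts r) tab)"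

lemma entry_SomeD: "entry tab ts = Some q \<Longrightarrow> \<exists>r. (r, q) \<in> set tab \<and> same ts r"
  by (induction tab) (auto simp: entry_def split: if_splits)

text \<open>
  \<open>Odd r w\<close> claims that the coefficient at \<open>r\<close> vanishes since the word \<open>w\<close>, an odd number of transpositions of
  values, fixes \<open>r\<close>.  \<open>Relation r q n ws\<close> claims that \<open>r\<close> is determined with factor \<open>q\<close>, by the raising
  relation at \<open>n\<close>; the words \<open>ws\<close> bring the terms of that relation to \<open>r\<close> or to a monomial that has
  been treated before.
\<close>

datatype step = Odd "cell list" "generator list"
  | Relation "cell list" int "cell list" "generator list list"

fun result :: "step \<Rightarrow> cell list \<times> int" where
  "result (Odd r w) = (r, 0)"
| "result (Relation r q n ws) = (r, q)"

text \<open>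
  An odd stabilizing word may not involve interchanges of directions: these relate coefficients of
  different invariants as long as the orbit is not known to be determined.  For the same reason exactly
  one term of a relation may lead to \<open>r\<close>: two such terms might need different words, and an interchange
  of directions in these words would introduce a second unknown.
\<close>

fun justified :: "table \<Rightarrow> step \<Rightarrow> bool" where
  "justified tab (Odd r w) \<longleftrightarrow>
     odd (length w) \<and> list_all (\<lambda>g. g \<in> set value_swaps) w \<and> same (transform w r) r"
| "justified tab (Relation r q n ws) \<longleftrightarrow>
     (let ps = zip (raised n) ws; tab' = (r, q) # tab in
      length ws = length (raised n) \<and>
      list_all (\<lambda>((c, u), w). entry tab' (transform w u) \<noteq> None) ps \<and>
      sum_list (map (\<lambda>((c, u), w). c * parity w * the (entry tab' (transform w u))) ps) = 0 \<and>
      length (filter (\<lambda>((c, u), w). same (transform w u) r) ps) = 1)"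

fun valid :: "table \<Rightarrow> step list \<Rightarrow> bool" where
  "valid tab [] \<longleftrightarrow> True"
| "valid tab (s # ss) \<longleftrightarrow> justified tab s \<and> valid (result s # tab) ss"

text \<open>
  In a relation, all terms but one are known multiples of the reference coefficient.  The remaining term
  has a positive integer as its coefficient, so the relation determines it, and the check that the
  predicted values satisfy the relation identifies its value.
\<close>

lemma determined_step:
  assumes tab: "\<forall>(ts, q) \<in> set tab. determined ts q" and just: "justified tab s"
  shows "case result s of (ts, q) \<Rightarrow> determined ts q"
proof (cases s)
  case (Odd r w)
  have "cell_coef f r = 0" if f: "invariant9 f" for f
  proof -
    have "cell_coef f r = cell_coef f (transform w r)"
      using just by (intro cell_coef_cong) (simp add: Odd same_iff)
    also have "\<dots> = - cell_coef f r"
      using just cell_coef_transform[OF f] by (simp add: Odd parity_def)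
    finally show ?thesis by simp
  qed
  then show ?thesis by (simp add: Odd determined_def)
next
  case (Relation r q n ws)
  let ?tab' = "(r, q) # tab"
  define val where "val = (\<lambda>((c :: int, u), w). parity w * the (entry ?tab' (transform w u)))"
  define hit where "hit = (\<lambda>((c :: int, u), w). same (transform w u) r)"
  define ps where "ps = zip (raised n) ws"
  have len: "length ws = length (raised n)"
    and found: "\<And>c u w. ((c, u), w) \<in> set ps \<Longrightarrow> entry ?tab' (transform w u) \<noteq> None"
    and sum0: "(\<Sum>((c, u), w)\<leftarrow>ps. c * parity w * the (entry ?tab' (transform w u))) = 0"
    and single: "length (filter hit ps) = 1"
    using just unfolding Relation justified.simps Let_def ps_def[symmetric] hit_def[symmetric]
    by (auto simp: list_all_iff)
  have "(\<Sum>p\<leftarrow>ps. fst (fst p) * val p)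
      = (\<Sum>((c, u), w)\<leftarrow>ps. c * parity w * the (entry ?tab' (transform w u)))"
    by (intro arg_cong[of _ _ sum_list] map_cong) (auto simp: val_def mult.assoc)
  with sum0 have total: "(\<Sum>p\<leftarrow>ps. fst (fst p) * val p) = 0" by simp
  from single obtain p where "filter hit ps = [p]"
    by (auto simp: length_Suc_conv)
  then obtain xs ys where split: "ps = xs @ p # ys"
    and miss: "\<forall>x\<in>set xs. \<not> hit x" "[] = filter hit ys" and hit: "hit p"
    unfolding filter_eq_Cons_iff by blast
  from miss(2) have "\<forall>x\<in>set ys. \<not> hit x"
    by (metis filter_empty_conv)
  with miss(1) have miss: "\<not> hit x" if "x \<in> set xs \<union> set ys" for x
    using that by blast
  obtain c u w where p: "p = ((c, u), w)" by (metis prod.collapse)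
  have known: "cell_coef f (snd (fst x)) = of_int (val x) * cell_coef f base_list"
    if x: "x \<in> set ps" "\<not> hit x" and f: "invariant9 f" for x f
  proof -
    obtain c' u' w' where x': "x = ((c', u'), w')" by (metis prod.collapse)
    have "entry ?tab' (transform w' u') = entry tab (transform w' u')"
      using x(2) by (auto simp: x' hit_def entry_def same_iff)
    then obtain q' where q': "entry tab (transform w' u') = Some q'" "val x = parity w' * q'"
      using found x(1) by (force simp: x' val_def)
    then obtain r' where r': "(r', q') \<in> set tab" "same (transform w' u') r'"
      using entry_SomeD by blast
    then have "determined (transform w' u') q'"
      using tab determined_cong[of "transform w' u'" r' q'] by (auto simp: same_iff)
    then have "determined u' (val x)"
      unfolding q'(2) by (rule determined_untransform)
    then show ?thesis
      using f by (simp add: determined_def x')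
  qed
  have "determined u (parity w * q)"
    unfolding determined_def
  proof (intro allI impI)
    fix f assume f: "invariant9 f"
    let ?b = "cell_coef f base_list"
    \<comment> \<open>The terms of the relation minus their predicted values; all but one are known to vanish.\<close>
    define gap where "gap = (\<lambda>x. of_int (fst (fst x)) * (cell_coef f (snd (fst x)) - of_int (val x) * ?b))"
    have "(\<Sum>x\<leftarrow>ps. of_int (fst (fst x)) * cell_coef f (snd (fst x))) = (\<Sum>(c, u)\<leftarrow>raised n. of_int c * cell_coef f u)"
    proof -
      have "raised n = map fst ps" by (simp add: ps_def len)
      then show ?thesis by (simp only: map_map comp_def case_prod_beta)
    qed
    also have "\<dots> = 0" by (rule raised_relation[OF f])
    finally have sum0: "(\<Sum>x\<leftarrow>ps. of_int (fst (fst x)) * cell_coef f (snd (fst x))) = 0" .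
    have "(\<Sum>x\<leftarrow>zs. gap x) = (\<Sum>x\<leftarrow>zs. of_int (fst (fst x)) * cell_coef f (snd (fst x)))
        - of_int (\<Sum>x\<leftarrow>zs. fst (fst x) * val x) * ?b" for zs
      by (induction zs) (simp_all add: gap_def algebra_simps)
    then have "(\<Sum>x\<leftarrow>ps. gap x) = 0" by (simp only: sum0 total) simp
    moreover have "gap x = 0" if "x \<in> set xs \<union> set ys" for x
      using that miss known[OF _ _ f, of x] by (auto simp: gap_def split)
    then have "map gap xs = map (\<lambda>_. 0) xs" "map gap ys = map (\<lambda>_. 0) ys" by auto
    ultimately have "gap p = 0" by (simp add: split)
    moreover have "c \<noteq> 0"
    proof -
      have "(c, u) \<in> set (raised n)"
        using split by (metis ps_def p in_set_conv_decomp set_zip_leftD)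
      then show ?thesis by (auto simp: raised_def)
    qed
    moreover have "val p = parity w * q"
      using hit by (simp add: p val_def hit_def entry_def)
    ultimately show "cell_coef f u = of_int (parity w * q) * ?b"
      by (simp add: gap_def p)
  qed
  from determined_transform[OF this, of w] have "determined (transform w u) q"
    by simp
  moreover have "mset (transform w u) = mset r"
    using hit by (simp add: hit_def p same_iff)
  ultimately show ?thesis
    using determined_cong[of "transform w u" r q] by (simp add: Relation)
qed

lemma valid_determined:
  assumes "\<forall>(ts, q) \<in> set tab. determined ts q" "valid tab ss"
  shows "\<forall>(ts, q) \<in> set (map result ss). determined ts q"
  using assms
proof (induction ss arbitrary: tab)
  case (Cons s ss)
  have "case result s of (ts, q) \<Rightarrow> determined ts q"
    using determined_step Cons.prems by simp
  with Cons.IH[of "result s # tab"] Cons.prems show ?case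
    by (auto simp: split_beta)
qed simp

text \<open>
  The 13 orbits in which a monomial is fixed by an odd element of \<open>S\<^sub>3 \<times> S\<^sub>3 \<times> S\<^sub>3\<close>.
\<close>

definition odd_steps :: "step list" where
  "odd_steps =
    [Odd [(I1, I1, I1), (I1, I1, I1), (I1, I1, I1), (I2, I2, I2), (I2, I2, I2), (I2, I2, I2),
      (I3, I3, I3), (I3, I3, I3), (I3, I3, I3)]
       [X12, Y12, Z12],
     Odd [(I1, I1, I1), (I1, I1, I1), (I1, I1, I1), (I2, I2, I2), (I2, I2, I2), (I2, I2, I3),
       (I3, I3, I2), (I3, I3, I3), (I3, I3, I3)]
       [X23, Y23, Z23],
     Odd [(I1, I1, I1), (I1, I1, I1), (I1, I1, I1), (I2, I2, I2), (I2, I2, I3), (I2, I3, I2),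
       (I3, I2, I3), (I3, I3, I2), (I3, I3, I3)]
       [X23, Y23, Z23],
     Odd [(I1, I1, I1), (I1, I1, I1), (I1, I1, I2), (I2, I2, I1), (I2, I2, I2), (I2, I2, I3),
       (I3, I3, I2), (I3, I3, I3), (I3, I3, I3)]
       [X13, Y13, Z13],
     Odd [(I1, I1, I1), (I1, I1, I1), (I1, I2, I2), (I2, I1, I2), (I2, I2, I3), (I2, I2, I3),
       (I3, I3, I1), (I3, I3, I2), (I3, I3, I3)]
       [X12, Y12, Z13],
     Odd [(I1, I1, I1), (I1, I1, I2), (I1, I1, I3), (I2, I2, I1), (I2, I2, I2), (I2, I2, I3),
       (I3, I3, I1), (I3, I3, I2), (I3, I3, I3)]
       [Z12],
     Odd [(I1, I1, I1), (I1, I1, I2), (I1, I1, I3), (I2, I2, I1), (I2, I2, I2), (I2, I3, I1),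
       (I3, I2, I3), (I3, I3, I2), (I3, I3, I3)]
       [X23, Y23, Z13],
     Odd [(I1, I1, I1), (I1, I1, I2), (I1, I1, I3), (I2, I2, I1), (I2, I2, I2), (I2, I3, I3),
       (I3, I2, I3), (I3, I3, I1), (I3, I3, I2)]
       [Z12],
     Odd [(I1, I1, I1), (I1, I1, I2), (I1, I2, I1), (I2, I1, I1), (I2, I2, I2), (I2, I3, I3),
       (I3, I2, I3), (I3, I3, I2), (I3, I3, I3)]
       [X13, Y13, Z13],
     Odd [(I1, I1, I1), (I1, I1, I2), (I1, I2, I1), (I2, I1, I3), (I2, I2, I2), (I2, I3, I1),
       (I3, I2, I3), (I3, I3, I2), (I3, I3, I3)]
       [X13, Y13, Z13],
     Odd [(I1, I1, I1), (I1, I1, I2), (I1, I2, I3), (I2, I1, I3), (I2, I2, I1), (I2, I3, I2),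
       (I3, I2, I2), (I3, I3, I1), (I3, I3, I3)]
       [X13, Y13, Z23],
     Odd [(I1, I1, I1), (I1, I1, I2), (I1, I2, I3), (I2, I1, I3), (I2, I3, I1), (I2, I3, I2),
       (I3, I2, I1), (I3, I2, I2), (I3, I3, I3)]
       [Z12],
     Odd [(I1, I1, I1), (I1, I2, I2), (I1, I3, I3), (I2, I1, I2), (I2, I2, I3), (I2, I3, I1),
       (I3, I1, I3), (I3, I2, I1), (I3, I3, I2)]
       [X12, Y12, Z13]]"

text \<open>
  The remaining 30 orbits, ordered such that each relation involves only one new orbit.  The orbits
  with coefficient 0 come first.
\<close>

definition relation_steps :: "step list" where
  "relation_steps =
    [Relation [(I1, I1, I1), (I1, I1, I1), (I1, I1, I2), (I2, I2, I1), (I2, I3, I2),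
      (I2, I3, I3), (I3, I2, I2), (I3, I2, I3), (I3, I3, I3)]
       0
       [(I1, I1, I1), (I1, I1, I1), (I1, I1, I1), (I1, I2, I2), (I2, I2, I3), (I2, I3, I2),
         (I3, I2, I3), (I3, I3, I2), (I3, I3, I3)]
       [[D13], []],
     Relation [(I1, I1, I1), (I1, I1, I1), (I1, I1, I2), (I2, I2, I1), (I2, I2, I2),
       (I2, I3, I2), (I3, I2, I3), (I3, I3, I3), (I3, I3, I3)]
       0
       [(I1, I1, I1), (I1, I1, I1), (I1, I1, I1), (I1, I2, I2), (I2, I2, I2), (I2, I2, I3),
         (I3, I3, I2), (I3, I3, I3), (I3, I3, I3)]
       [[D13, D12], []],
     Relation [(I1, I1, I1), (I1, I1, I1), (I1, I1, I2), (I2, I2, I1), (I2, I2, I3),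
       (I2, I3, I2), (I3, I2, I3), (I3, I3, I2), (I3, I3, I3)]
       0
       [(I1, I1, I1), (I1, I1, I1), (I1, I1, I1), (I1, I2, I2), (I2, I3, I2), (I2, I3, I3),
         (I3, I2, I2), (I3, I2, I3), (I3, I3, I3)]
       [[D13], [Y23]],
     Relation [(I1, I1, I1), (I1, I1, I1), (I1, I1, I2), (I2, I2, I1), (I2, I3, I2),
       (I2, I3, I2), (I3, I2, I3), (I3, I2, I3), (I3, I3, I3)]
       0
       [(I1, I1, I1), (I1, I1, I1), (I1, I1, I1), (I1, I2, I2), (I2, I2, I3), (I2, I2, I3),
         (I3, I3, I2), (I3, I3, I2), (I3, I3, I3)]
       [[D13, D12], [Z23]],
     Relation [(I1, I1, I1), (I1, I1, I1), (I1, I1, I2), (I2, I2, I1), (I2, I2, I3),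
       (I2, I2, I3), (I3, I3, I2), (I3, I3, I2), (I3, I3, I3)]
       0
       [(I1, I1, I1), (I1, I1, I1), (I1, I1, I1), (I1, I2, I2), (I2, I3, I3), (I2, I3, I3),
         (I3, I2, I2), (I3, I2, I2), (I3, I3, I3)]
       [[D13], [D13, Z23]],
     Relation [(I1, I1, I1), (I1, I1, I1), (I1, I1, I2), (I2, I2, I1), (I2, I2, I3),
       (I2, I3, I3), (I3, I2, I3), (I3, I3, I2), (I3, I3, I2)]
       0
       [(I1, I1, I1), (I1, I1, I1), (I1, I2, I2), (I1, I2, I2), (I2, I2, I3), (I2, I3, I2),
         (I3, I1, I1), (I3, I3, I3), (I3, I3, I3)]
       [[D13, Z13, Y13, X13], [D13, Z23]],
     Relation [(I1, I1, I1), (I1, I1, I1), (I1, I1, I2), (I2, I2, I1), (I2, I3, I2),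
       (I2, I3, I3), (I3, I2, I3), (I3, I2, I3), (I3, I3, I2)]
       0
       [(I1, I2, I3), (I1, I2, I3), (I1, I3, I2), (I1, I3, I2), (I2, I2, I1), (I2, I3, I3),
         (I3, I1, I1), (I3, I1, I1), (I3, I1, I2)]
       [[X13], [X13]],
     Relation [(I1, I1, I1), (I1, I1, I1), (I1, I1, I1), (I2, I2, I2), (I2, I2, I2),
       (I2, I3, I3), (I3, I2, I3), (I3, I3, I2), (I3, I3, I3)]
       0
       [(I1, I1, I1), (I1, I1, I1), (I1, I1, I1), (I1, I2, I2), (I2, I3, I2), (I2, I3, I3),
         (I3, I2, I3), (I3, I2, I3), (I3, I3, I2)]
       [[D13], [Z23, X23]],
     Relation [(I1, I1, I1), (I1, I1, I1), (I1, I1, I2), (I2, I2, I1), (I2, I2, I2),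
       (I2, I3, I3), (I3, I2, I3), (I3, I3, I2), (I3, I3, I3)]
       0
       [(I1, I1, I1), (I1, I1, I1), (I1, I1, I1), (I1, I2, I2), (I2, I2, I2), (I2, I3, I3),
         (I3, I2, I3), (I3, I3, I2), (I3, I3, I3)]
       [[D13], []],
     Relation [(I1, I1, I1), (I1, I1, I1), (I1, I1, I2), (I2, I2, I1), (I2, I2, I3),
       (I2, I3, I2), (I3, I2, I2), (I3, I3, I3), (I3, I3, I3)]
       0
       [(I1, I1, I1), (I1, I1, I1), (I1, I1, I1), (I1, I2, I2), (I2, I2, I3), (I2, I3, I2),
         (I3, I2, I2), (I3, I3, I3), (I3, I3, I3)]
       [[D13], [Z23, Y23, X23]],
     Relation [(I1, I1, I1), (I1, I1, I1), (I1, I2, I2), (I2, I1, I3), (I2, I2, I2),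
       (I2, I2, I3), (I3, I3, I1), (I3, I3, I2), (I3, I3, I3)]
       0
       [(I1, I1, I1), (I1, I1, I1), (I1, I2, I2), (I1, I2, I2), (I2, I1, I3), (I2, I3, I3),
         (I3, I2, I2), (I3, I3, I1), (I3, I3, I3)]
       [[D13, Z23, Y12, X12], [D13, Z23, Y23, X23]],
     Relation [(I1, I1, I1), (I1, I1, I2), (I1, I2, I1), (I2, I1, I1), (I2, I2, I3),
       (I2, I3, I2), (I3, I2, I3), (I3, I3, I2), (I3, I3, I3)]
       0
       [(I1, I1, I1), (I1, I1, I1), (I1, I1, I2), (I1, I2, I1), (I2, I2, I3), (I2, I3, I2),
         (I3, I2, I3), (I3, I3, I2), (I3, I3, I3)]
       [[], [D23], []],
     Relation [(I1, I1, I1), (I1, I1, I1), (I1, I2, I2), (I2, I1, I2), (I2, I2, I1),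
       (I2, I3, I3), (I3, I2, I3), (I3, I3, I2), (I3, I3, I3)]
       0
       [(I1, I1, I1), (I1, I1, I1), (I1, I1, I2), (I1, I2, I1), (I2, I2, I3), (I2, I3, I2),
         (I3, I2, I2), (I3, I3, I3), (I3, I3, I3)]
       [[Z13, Y13, X13], [D23], []],
     Relation [(I1, I1, I1), (I1, I1, I1), (I1, I2, I2), (I2, I1, I2), (I2, I2, I2),
       (I2, I3, I3), (I3, I2, I3), (I3, I3, I1), (I3, I3, I3)]
       0
       [(I1, I1, I1), (I1, I1, I1), (I1, I2, I2), (I1, I3, I3), (I2, I1, I2), (I2, I2, I1),
         (I3, I2, I3), (I3, I3, I2), (I3, I3, I3)]
       [[X12], [D13], []],
     Relation [(I1, I1, I1), (I1, I1, I1), (I1, I2, I2), (I2, I1, I2), (I2, I2, I3),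
       (I2, I3, I3), (I3, I2, I3), (I3, I3, I1), (I3, I3, I2)]
       0
       [(I1, I1, I1), (I1, I1, I1), (I1, I3, I3), (I1, I3, I3), (I2, I1, I2), (I2, I2, I1),
         (I3, I2, I2), (I3, I2, I3), (I3, I3, I2)]
       [[D13, Z23, Y13, X13], [D13]],
     Relation [(I1, I1, I1), (I1, I1, I2), (I1, I2, I1), (I2, I1, I2), (I2, I2, I3),
       (I2, I3, I3), (I3, I2, I3), (I3, I3, I1), (I3, I3, I2)]
       0
       [(I1, I1, I1), (I1, I1, I1), (I1, I1, I2), (I1, I2, I2), (I2, I2, I3), (I2, I3, I3),
         (I3, I2, I3), (I3, I3, I1), (I3, I3, I2)]
       [[Z12], [], [Y23, X23]],
     Relation [(I1, I1, I1), (I1, I1, I2), (I1, I2, I1), (I2, I1, I3), (I2, I3, I1),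
       (I2, I3, I3), (I3, I2, I2), (I3, I2, I3), (I3, I3, I2)]
       0
       [(I1, I1, I1), (I1, I1, I1), (I1, I1, I2), (I1, I2, I3), (I2, I3, I2), (I2, I3, I3),
         (I3, I2, I1), (I3, I2, I3), (I3, I3, I2)]
       [[D12], [D23, Y23, X23], [X23]],
     Relation (leading_lists ! 9) 1
       [(I1, I1, I1), (I1, I1, I1), (I1, I1, I2), (I1, I2, I3), (I2, I3, I3), (I2, I3, I3),
         (I3, I2, I2), (I3, I2, I2), (I3, I3, I1)]
       [[D12, Z13, Y13], [Z12, Y13], [Y23, X23]],
     Relation (leading_lists ! 12) 1
       [(I1, I2, I2), (I1, I2, I2), (I1, I3, I1), (I1, I3, I3), (I2, I1, I3), (I2, I3, I2),
         (I3, I1, I1), (I3, I1, I1), (I3, I2, I3)]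
       [[Z23, X13], [Y23], [Y12, X12]],
     Relation (leading_lists ! 3) 1
       [(I1, I1, I1), (I1, I1, I1), (I1, I1, I3), (I1, I3, I3), (I2, I2, I1), (I2, I2, I2),
         (I3, I2, I3), (I3, I3, I2), (I3, I3, I2)]
       [[Z12, Y13, Y12, X23], [X13], [Z23]],
     Relation (leading_lists ! 5) 1
       [(I1, I1, I3), (I1, I1, I3), (I1, I2, I2), (I1, I2, I2), (I2, I3, I1), (I2, I3, I3),
         (I3, I1, I2), (I3, I2, I1), (I3, I3, I1)]
       [[D13], [D23, D12]],
     Relation (leading_lists ! 11) 1
       [(I1, I1, I1), (I1, I1, I1), (I1, I2, I2), (I1, I2, I2), (I2, I2, I3), (I2, I3, I3),
         (I3, I1, I3), (I3, I3, I1), (I3, I3, I2)]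
       [[D12, Y13, X12], [D23, Z23, X13, X12]],
     Relation (leading_lists ! 2) 1
       [(I1, I1, I3), (I1, I2, I2), (I1, I2, I2), (I1, I3, I3), (I2, I1, I3), (I2, I3, I1),
         (I3, I1, I2), (I3, I2, I1), (I3, I3, I1)]
       [[D13, X23], [D13], [D13]],
     Relation (leading_lists ! 4) 1
       [(I1, I1, I1), (I1, I1, I1), (I1, I1, I2), (I1, I3, I3), (I2, I2, I1), (I2, I3, I2),
         (I3, I2, I2), (I3, I2, I3), (I3, I3, I3)]
       [[D13, Z12, X13], [Y23, X13], []],
     Relation (leading_lists ! 0) 1
       [(I1, I2, I2), (I1, I3, I1), (I1, I3, I1), (I1, I3, I2), (I2, I1, I3), (I2, I2, I3),
         (I3, I1, I2), (I3, I1, I3), (I3, I2, I1)]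
       [[Y13, X23], [D12], [D13, D12]],
     Relation (leading_lists ! 6) 1
       [(I1, I1, I1), (I1, I1, I1), (I1, I1, I2), (I1, I2, I2), (I2, I2, I3), (I2, I3, I1),
         (I3, I2, I3), (I3, I3, I2), (I3, I3, I3)]
       [[Z23, Z12, Y13], [D23, X13], [Y23]],
     Relation (leading_lists ! 10) 1
       [(I1, I1, I1), (I1, I1, I1), (I1, I2, I1), (I1, I2, I3), (I2, I1, I2), (I2, I3, I2),
         (I3, I2, I3), (I3, I3, I2), (I3, I3, I3)]
       [[X13], [D13, Z23, Y12, X12], [D23]],
     Relation (leading_lists ! 1) 1
       [(I1, I1, I3), (I1, I1, I3), (I1, I2, I2), (I1, I3, I1), (I2, I2, I3), (I2, I3, I2),
         (I3, I1, I2), (I3, I2, I1), (I3, I3, I1)]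
       [[D13, Z12, X13], [D13, Z12], [D13]],
     Relation (leading_lists ! 8) 1
       [(I1, I1, I2), (I1, I1, I2), (I1, I2, I1), (I1, I3, I1), (I2, I1, I3), (I2, I2, I1),
         (I3, I2, I3), (I3, I3, I2), (I3, I3, I3)]
       [[X13], [X23, X12], [X13]],
     Relation (leading_lists ! 7) 1
       [(I1, I1, I3), (I1, I1, I3), (I1, I2, I2), (I1, I3, I2), (I2, I2, I1), (I2, I3, I1),
         (I3, I1, I2), (I3, I2, I3), (I3, I3, I1)]
       [[D13, Z23], [D23, D12, Y23], [Z13, X23]]]"

definition table :: table where
  "table = (base_list, 1) # map result (odd_steps @ relation_steps)"

lemma steps_valid: "valid [(base_list, 1)] (odd_steps @ relation_steps)"
  by code_simp

lemma table_determined: "(ts, q) \<in> set table \<Longrightarrow> determined ts q"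
proof -
  have base: "determined base_list 1" by (simp add: determined_def)
  have "\<forall>(ts, q) \<in> set (map result (odd_steps @ relation_steps)). determined ts q"
    by (rule valid_determined[OF _ steps_valid]) (simp add: base)
  then show "(ts, q) \<in> set table \<Longrightarrow> determined ts q"
    using base by (auto simp: table_def)
qed

lemma table_leading:
  "list_all (\<lambda>(r, q). q = 0 \<or> q = 1 \<and> r \<in> set leading_lists) table"
  "list_all (\<lambda>r. (r, 1) \<in> set table) leading_lists"
  by code_simp+

section \<open>Every balanced array is equivalent to one in the table\<close>

definition balanced :: "cell list \<Rightarrow> bool" where
  "balanced ts \<longleftrightarrow> (\<forall>v. occurs fst v ts = 3 \<and> occurs (fst \<circ> snd) v ts = 3 \<and> occurs (snd \<circ> snd) v ts = 3)"

lemma occurs_mset: "occurs c v ts = size (filter_mset (\<lambda>t. c t = v) (mset ts))"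
  by (simp add: occurs_def flip: mset_filter)

lemma balanced_cong: "mset ts = mset us \<Longrightarrow> balanced ts = balanced us"
  by (simp add: balanced_def occurs_mset)

lemma occurs_map: "occurs c v (map g ts) = occurs (c \<circ> g) v ts"
  by (simp add: occurs_def filter_map comp_def)

lemma occurs_append: "occurs c v (ts @ us) = occurs c v ts + occurs c v us"
  by (simp add: occurs_def)

lemma occurs_Cons: "occurs c v (t # ts) = (if c t = v then 1 else 0) + occurs c v ts"
  by (simp add: occurs_def)

lemma occurs_eq_0: "occurs c v ts = 0 \<longleftrightarrow> v \<notin> c ` set ts"
  by (auto simp: occurs_def filter_empty_conv)

lemma occurs_swap:
  "occurs (\<lambda>t. swap12 (c t)) v ts = occurs c (swap12 v) ts"
  "occurs (\<lambda>t. swap13 (c t)) v ts = occurs c (swap13 v) ts"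
  "occurs (\<lambda>t. swap23 (c t)) v ts = occurs c (swap23 v) ts"
proof -
  have "swap12 i = v \<longleftrightarrow> i = swap12 v" "swap13 i = v \<longleftrightarrow> i = swap13 v"
    "swap23 i = v \<longleftrightarrow> i = swap23 v" for i
    by (cases i; cases v; simp)+
  then show "occurs (\<lambda>t. swap12 (c t)) v ts = occurs c (swap12 v) ts"
    "occurs (\<lambda>t. swap13 (c t)) v ts = occurs c (swap13 v) ts"
    "occurs (\<lambda>t. swap23 (c t)) v ts = occurs c (swap23 v) ts"
    by (simp_all add: occurs_def)
qed

lemma balanced_move: "balanced ts \<Longrightarrow> balanced (map (move g) ts)"
proof -
  have "fst (move g t) = (case g of X12 \<Rightarrow> swap12 (fst t) | X13 \<Rightarrow> swap13 (fst t) | X23 \<Rightarrow> swap23 (fst t)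
      | D12 \<Rightarrow> fst (snd t) | D13 \<Rightarrow> snd (snd t) | _ \<Rightarrow> fst t)"
   "fst (snd (move g t)) = (case g of Y12 \<Rightarrow> swap12 (fst (snd t)) | Y13 \<Rightarrow> swap13 (fst (snd t)) | Y23 \<Rightarrow> swap23 (fst (snd t))
      | D12 \<Rightarrow> fst t | D23 \<Rightarrow> snd (snd t) | _ \<Rightarrow> fst (snd t))"
   "snd (snd (move g t)) = (case g of Z12 \<Rightarrow> swap12 (snd (snd t)) | Z13 \<Rightarrow> swap13 (snd (snd t)) | Z23 \<Rightarrow> swap23 (snd (snd t))
      | D13 \<Rightarrow> fst t | D23 \<Rightarrow> fst (snd t) | _ \<Rightarrow> snd (snd t))" for t
    by (cases t; cases g; simp)+
  then show "balanced ts \<Longrightarrow> balanced (map (move g) ts)"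
    unfolding balanced_def occurs_map by (cases g) (simp_all add: comp_def occurs_swap)
qed

lemma balanced_transform: "balanced ts \<Longrightarrow> balanced (transform w ts)"
  by (induction w arbitrary: ts) (simp_all add: transform_Cons balanced_move)

lemma length_balanced: "balanced ts \<Longrightarrow> length ts = 9"
proof -
  have "length ts = occurs fst I1 ts + occurs fst I2 ts + occurs fst I3 ts"
  proof (induction ts)
    case (Cons t ts)
    then show ?case by (cases "fst t") (simp_all add: occurs_Cons)
  qed (simp add: occurs_def)
  then show "balanced ts \<Longrightarrow> length ts = 9" by (simp add: balanced_def)
qed

text \<open>
  Candidates for the balanced lists that extend \<open>acc\<close> by \<open>n\<close> cells taken in order, with repetition, from
  the given ones.  A cell is added only while none of its three index values occurs three times.  The
  search proceeds to the later cells only if each of the first two index values of the current cell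
  occurs three times already or can still be supplied.
\<close>

fun fillings :: "nat \<Rightarrow> cell list \<Rightarrow> cell list \<Rightarrow> cell list list" where
  "fillings 0 xs acc = [acc]"
| "fillings (Suc n) [] acc = []"
| "fillings (Suc n) (x # xs) acc =
     (let f1 = (occurs fst (fst x) acc = 3); f2 = (occurs (fst \<circ> snd) (fst (snd x)) acc = 3);
          f3 = (occurs (snd \<circ> snd) (snd (snd x)) acc = 3)
      in (if f1 \<or> f2 \<or> f3 then [] else fillings n (x # xs) (x # acc)) @
         (if (f1 \<or> fst x \<in> fst ` set xs) \<and> (f2 \<or> fst (snd x) \<in> (fst \<circ> snd) ` set xs)
          then fillings (Suc n) xs acc else []))"

lemma fillings_complete:
  assumes "set us \<subseteq> set xs" "length us = n" "balanced (acc @ us)"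
  shows "\<exists>zs \<in> set (fillings n xs acc). mset zs = mset (acc @ us)"
  using assms
proof (induction n xs acc arbitrary: us rule: fillings.induct)
  case (3 n x xs acc)
  note bal = \<open>balanced (acc @ us)\<close>
  define f1 where "f1 \<longleftrightarrow> occurs fst (fst x) acc = 3"
  define f2 where "f2 \<longleftrightarrow> occurs (fst \<circ> snd) (fst (snd x)) acc = 3"
  define f3 where "f3 \<longleftrightarrow> occurs (snd \<circ> snd) (snd (snd x)) acc = 3"
  note IH = "3.IH"[OF f1_def f2_def f3_def]
  have unfold: "set (fillings (Suc n) (x # xs) acc) =
      (if f1 \<or> f2 \<or> f3 then {} else set (fillings n (x # xs) (x # acc))) \<union>
      (if (f1 \<or> fst x \<in> fst ` set xs) \<and> (f2 \<or> fst (snd x) \<in> (fst \<circ> snd) ` set xs)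
          then set (fillings (Suc n) xs acc) else {})"
    by (simp add: f1_def f2_def f3_def Let_def)
  show ?case
  proof (cases "x \<in> set us")
    case True
    then have us: "mset (acc @ us) = mset ((x # acc) @ remove1 x us)" by simp
    with bal have bal': "balanced ((x # acc) @ remove1 x us)"
      using balanced_cong by blast
    then have "occurs fst (fst x) ((x # acc) @ remove1 x us) = 3"
      "occurs (fst \<circ> snd) (fst (snd x)) ((x # acc) @ remove1 x us) = 3"
      "occurs (snd \<circ> snd) (snd (snd x)) ((x # acc) @ remove1 x us) = 3"
      unfolding balanced_def by blast+
    then have not_full: "\<not> f1" "\<not> f2" "\<not> f3"
      by (simp_all add: occurs_append occurs_Cons f1_def f2_def f3_def)
    then have none: "\<not> (f1 \<or> f2 \<or> f3)" by blast
    have sub: "set (remove1 x us) \<subseteq> set (x # xs)"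
      by (rule order_trans[OF set_remove1_subset "3.prems"(1)])
    have len: "length (remove1 x us) = n"
      using "3.prems"(2) True by (simp add: length_remove1)
    obtain zs where "zs \<in> set (fillings n (x # xs) (x # acc))"
      "mset zs = mset ((x # acc) @ remove1 x us)"
      using IH(1)[OF none sub len bal'] by blast
    then show ?thesis unfolding unfold us if_not_P[OF none] by blast
  next
    case False
    then have sub: "set us \<subseteq> set xs" using "3.prems" by auto
    have "f1 \<or> fst x \<in> fst ` set xs"
    proof (rule ccontr)
      assume *: "\<not> ?thesis"
      then have "occurs fst (fst x) us = 0" using sub by (auto simp: occurs_eq_0)
      moreover have "occurs fst (fst x) (acc @ us) = 3" using bal unfolding balanced_def by blast
      ultimately show False using * by (simp add: occurs_append f1_def)
    qed
    moreover have "f2 \<or> fst (snd x) \<in> (fst \<circ> snd) ` set xs"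
    proof (rule ccontr)
      assume *: "\<not> ?thesis"
      then have "occurs (fst \<circ> snd) (fst (snd x)) us = 0"
        unfolding occurs_eq_0 using sub by blast
      moreover have "occurs (fst \<circ> snd) (fst (snd x)) (acc @ us) = 3"
        using bal unfolding balanced_def by blast
      ultimately show False using * by (simp add: occurs_append f2_def)
    qed
    ultimately have both: "(f1 \<or> fst x \<in> fst ` set xs) \<and> (f2 \<or> fst (snd x) \<in> (fst \<circ> snd) ` set xs)"
      by blast
    from IH(2)[OF this sub "3.prems"(2) bal] show ?thesis
      unfolding unfold if_P[OF both] by blast
  qed
qed auto

fun multisets :: "nat \<Rightarrow> 'a list \<Rightarrow> 'a list list" where
  "multisets 0 xs = [[]]"
| "multisets (Suc n) [] = []"
| "multisets (Suc n) (x # xs) = map (Cons x) (multisets n (x # xs)) @ multisets (Suc n) xs"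

lemma multisets_complete:
  "set us \<subseteq> set xs \<Longrightarrow> \<exists>zs \<in> set (multisets (length us) xs). mset zs = mset us"
proof (induction "length us" xs arbitrary: us rule: multisets.induct)
  case (3 n x xs)
  show ?case
  proof (cases "x \<in> set us")
    case True
    then have "length (remove1 x us) = n" using "3.hyps"(3) by (simp add: length_remove1)
    moreover have "set (remove1 x us) \<subseteq> set (x # xs)"
      using "3.prems" set_remove1_subset[of x us] by auto
    ultimately obtain zs where "zs \<in> set (multisets n (x # xs))" "mset zs = mset (remove1 x us)"
      using "3.hyps"(1)[of "remove1 x us"] by auto
    then show ?thesis using True "3.hyps"(3)[symmetric]
      by (intro bexI[of _ "x # zs"]) auto
  next
    case False
    then have "set us \<subseteq> set xs" using "3.prems" by auto
    from "3.hyps"(2)[OF "3.hyps"(3) this] show ?thesis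
      using "3.hyps"(3)[symmetric] by auto
  qed
qed auto

definition front :: "cell list \<Rightarrow> (idx \<times> idx) list" where
  "front ts = map snd (filter (\<lambda>t. fst t = I1) ts)"

text \<open>
  The numbers of distinct cells, rows and columns that are met by a slice.  For slices with three cells
  their product takes a different value on each of the seven classes under permutations of rows and
  columns and transposition; it is 1, 4, 8, 9, 12, 18 or 27.
\<close>

definition spread :: "(idx \<times> idx) list \<Rightarrow> nat" where
  "spread P = length (remdups P) * length (remdups (map fst P)) * length (remdups (map snd P))"

lemma spread_card: "spread P = card (set P) * card (fst ` set P) * card (snd ` set P)"
  by (simp add: spread_def length_remdups_card_conv)

lemma spread_cong: "mset P = mset Q \<Longrightarrow> spread P = spread Q"
  unfolding spread_card by (metis set_mset_mset)

lemma front_cong: "mset ts = mset us \<Longrightarrow> mset (front ts) = mset (front us)"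
  by (simp add: front_def mset_filter)

lemma front_Pair: "filter (\<lambda>t. fst t = I1) ts = map (Pair I1) (front ts)"
  unfolding front_def map_map by (rule map_idI[symmetric]) auto

text \<open>
  The eight words move the other eight slices to the front, so the front slice of a minimal list has
  the least spread among all nine slices.
\<close>

definition minimal :: "cell list \<Rightarrow> bool" where
  "minimal ts \<longleftrightarrow> (let s = spread (front ts) in list_all (\<lambda>w. s \<le> spread (front (transform w ts)))
     [[X12], [X13], [D12], [D12, X12], [D12, X13], [D13], [D13, X12], [D13, X13]])"

definition slice_words :: "generator list list" where
  "slice_words = [d @ y @ z. d \<leftarrow> [[], [D23]],
     y \<leftarrow> [[], [Y12], [Y13], [Y23], [Y12, Y13], [Y13, Y12]],
     z \<leftarrow> [[], [Z12], [Z13], [Z23], [Z12, Z13], [Z13, Z12]]]"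

definition standard :: "(idx \<times> idx) list \<Rightarrow> (idx \<times> idx) list \<Rightarrow> bool" where
  "standard P C \<longleftrightarrow> spread C = spread P \<and>
     list_ex (\<lambda>w. same (transform w (map (Pair I1) P)) (map (Pair I1) C)) slice_words"

definition index_pairs :: "(idx \<times> idx) list" where
  "index_pairs = [(j, k). j \<leftarrow> [I1, I2, I3], k \<leftarrow> [I1, I2, I3]]"

definition later_cells :: "cell list" where
  "later_cells = [(i, j, k). i \<leftarrow> [I2, I3], j \<leftarrow> [I1, I2, I3], k \<leftarrow> [I1, I2, I3]]"

text \<open>
  One slice of each class, together with words that lead from the minimal balanced lists with this
  front slice, in the order of their enumeration, to the table.
\<close>

definition standard_slices :: "((idx \<times> idx) list \<times> generator list list) list" where
  "standard_slices =
    [([(I1, I1), (I1, I1), (I1, I1)],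
      [[], [], [D23], [D13], [], [Z23], [Z23, Y23, X23], [], [Z23], [Y23, X23], [D23, Z23],
       [Y23], [Z23, X23], [D13, Z23], [Z23, Y23], [Z23], [Z23], [D13, X23], [D23, Y23], [Y23],
       [D13, Y23], [X23], [X23], [D23, X23], [Y23], [Y23], [X23], [X23]]),
     ([(I1, I1), (I1, I1), (I1, I2)],
      [[], [], [D12], [], [], [], [], [D12], [], [], [], [], [D12], [D12], [Y23, X23], [Y23],
       [D12, Y23], [Y23, X23], [Y23, X23], [Y23], [Y23], [D12, Y23], [D12, Y23, X23], [X23],
       [Y23, X23], [Y23, X23], [Y23], [Y23], [Y23], [D12, Y23], [D12, Y23, X23], [D12, Y23],
       [X23], [Y23, X23], [D12, X23], [D12, X23], [X23], [Y23, X23], [D12, Y23, X23], [X23],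
       [Y23, X23], [Y23], [D12, X23], [Y23], [D12, X23], [X23], [D12, Y23, X23], [X23], [X23],
       [Y23, X23], [X23], [Y23, X23], [Y23], [Y23], [X23], [X23]]),
     ([(I1, I1), (I1, I1), (I2, I2)],
      [[], [], [], [D13, Z23, X13], [D23, X13], [D23, D12, Z23, X13], [D13, Y23, X13],
       [D13, Z23, X13], [D23, D12, Y23, X13], [], [D12, Z23, Y12, X12], [Z23, Y23, X13],
       [Z23, Y12, X12], [Z23, Y12, X13, X12], [D12, Z23, Y23, X13], [D12, Z23, Y12, X13, X12],
       [D13, D12, Z23, X13], [X13], [D13, Z23, Y12, X23, X12], [D23, Z23, Y23, X13], [],
       [D13, Y23, X23], [D13, Y23, X23], [D13, Z23, Z12, Y23, X12], [Z12, X13], [D12, X13],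
       [D13, Z23, Y23, X23], [D12, Z12, Y13], [Z23, X13], [D13, Z23, Y23, Y12, X13], [D23, X23],
       [Z23, Z12, Y13], [D12, Z23, Z12, X13], [D23, X23], [D23, X23], [D23, Z23, X13],
       [D12, Z23, Z12, Y23, X23, X12], [D13, Y23, X23], [Z12, Y23, X23, X12], [Y12, X13, X12],
       [D23, X23], [D13, D12, Z23, Y23, X13], [D23, Z12, X13, X12], [D23], [D12, Z23, X13],
       [D13, D12, Y23, X13], [Z23, Y12, X23, X12], [Z12, Y23, X12], [D23], [D13, X13],
       [D12, Y23, X13], [D23], [D23, D12, Z23, Y23, X13], [D13, Z12, Y23, X12],
       [D12, Z23, Y23, Y12, X13, X12], [D23, Z12, X13], [D13, Z23, Y23, X23],
       [D13, D12, Y12, X23, X12], [D23, Z23, X13, X12], [D23], [D23, D12, X13], [D13, Y23, X23],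
       [Z23, Z12, Y13, X23], [D13, Y12, X23, X12], [Z23, X13, X12], [D13, X13], [D13, D12, X13],
       [D13, Z23, Y23, X23], [Z23, Y12, X13], [Y12, X13], [Z23, Y23, X13, X12],
       [D12, Z23, Z12, X23, X12], [X23], [D12, Z12, Y13, Y12], [D12, Z23, Z12, Y23, X13], [X23],
       [D13, Z23, Y23, X13], [Z12, X13, X12], [D23, Z23, Y23, X13, X12], [D13, Y23, Y12, X13],
       [X23], [D23, X13, X12], [X13, X12], [D13, Z23, Y23, X23], [X23], [X23]]),
     ([(I1, I1), (I1, I2), (I1, I3)],
      [[], [], [Z12], [D12], [D12, Z12], [], [Z23], [D12, Z23], [Z23], [D12, Z23, Z12],
       [Z23, Z12], [Y23], [Z23, Y23], [D12, Y23], [D12, Z23, Y23], [Z13, X23], [Z13],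
       [D12, Z13, Z12], [D12, Z13], [Z13, Z12], [Z13], [Z12, Y23], [D12, Z12, Y23], [Z23, X23],
       [D12, Z23, X23], [Z23, X23], [X23], [D12, Z12, X23], [D12, X23], [Z12, X23], [X23], [X23]]),
     ([(I1, I1), (I1, I2), (I2, I1)],
      [[], [], [D12], [D13], [Z13, Y13, X13], [D12, Z23, Z12, Y13, X13], [X13], [Z13, Y13],
       [D12, Z23, Z12, Y13], [D12, Z12, X13], [], [D23, Z23, X13], [D13, X13], [D23, X13],
       [Z23, X13], [], [D23, Z13, Y13], [D23, D12, Z12, Y23, X13],
       [D13, Z13, Z12, Y23, Y12, X23, X12], [D23, Z13, Y13, X23], [D23, Y23, X13], [D23, X23],
       [Z13, Y13], [Z13, Y13, X23], [Y23, X13], [], [D13, Z13, Z12, Y23, Y12, X13],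
       [D23, Z13, Y13, X23], [Z13, Y13, X23], [D13, Z13, Y23, Y12, X13], [D23, Z13, Y13],
       [D12, X23, X12], [D12, Z23, Z12, Y13, Y12], [D23, D12, Z12, X13], [D23], [Z13, Y13],
       [X23], [D13, Z23], [D23, Z23, X13, X12], [Y23, X13, X12], [D12, Z12, Y23, X13],
       [D13, Z13, Y23, Y12, X23, X12], [Z13, Y13, X23], [D12, Y23], [Z23, X13, X12],
       [D23, Y23, X13, X12], [X23], [D23, Z13, Y13], [Z13, Y13], [D12, Z23, Z12, Y13, Y12, X13],
       [Z13, Y13, X23], [D23, Z13, Y13, X23], [X23], [X23], [Z13, Y13, X13, X12], [X13, X12],
       [D23, X13, X12], [X23]]),
     ([(I1, I1), (I1, I2), (I2, I3)],
      [[], [Z12], [], [X23], [Z12, X23], [X23]]),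
     ([(I1, I1), (I2, I2), (I3, I3)],
      [[], [X23]])]"

lemma slices_standard:
  "list_all (\<lambda>P. list_ex (\<lambda>(C, ws). standard P C) standard_slices) (multisets 3 index_pairs)"
  by code_simp

definition covered :: "cell list list \<Rightarrow> cell list \<Rightarrow> generator list \<Rightarrow> bool" where
  "covered rs ts w \<longleftrightarrow> (let us = transform w ts in list_ex (same us) rs)"

lemma standard_slices_covered:
  "let rs = map fst table in list_all (\<lambda>(P, ws). list_all2 (covered rs)
     (filter minimal (fillings 6 later_cells (map (Pair I1) P))) ws) standard_slices"
  by code_simp

lemma fst_slice_word:
  assumes "w \<in> set slice_words"
  shows "fst (fold move w t) = fst t"
proof -
  have "list_all (\<lambda>w. list_all (\<lambda>g. g \<in> set [Y12, Y13, Y23, Z12, Z13, Z23, D23]) w) slice_words"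
    by code_simp
  then have "\<forall>g \<in> set w. g \<in> {Y12, Y13, Y23, Z12, Z13, Z23, D23}"
    using assms by (auto simp: list_all_iff)
  then show ?thesis
  proof (induction w arbitrary: t)
    case (Cons g w)
    have "fst (move g t) = fst t"
      using Cons.prems by (cases t) auto
    then show ?case using Cons by simp
  qed simp
qed

lemma list_all2_partner: "list_all2 P xs ys \<Longrightarrow> x \<in> set xs \<Longrightarrow> \<exists>y. P x y"
  by (induction rule: list_all2_induct) auto

text \<open>
  A symmetry brings a slice of least spread to the front, and a further one makes it one of the seven
  standard slices.  This leaves only 268 completions, each of which is led to the table by an explicit
  word.
\<close>

theorem balanced_in_table:
  assumes bal: "balanced ts"
  shows "\<exists>w. \<exists>(r, q) \<in> set table. mset (transform w ts) = mset r"
proof -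
  define m where "m = (\<lambda>w. spread (front (transform w ts)))"
  obtain w0 where w0: "\<And>w. m w0 \<le> m w"
    using ex_has_least_nat[of "\<lambda>_. True" _ m] by auto
  \<comment> \<open>\<open>ts1\<close> has a front slice of least spread, and \<open>ts2\<close> also has one in standard form.\<close>
  define ts1 where "ts1 = transform w0 ts"
  define P where "P = front ts1"
  have bal1: "balanced ts1" using bal by (simp add: ts1_def balanced_transform)
  have "length P = 3"
    using bal1 by (simp add: P_def front_def balanced_def occurs_def)
  moreover have "set P \<subseteq> set index_pairs"
  proof -
    have "x \<in> set index_pairs" for x
      by (cases x; cases "fst x"; cases "snd x") (auto simp: index_pairs_def)
    then show ?thesis by blast
  qed
  ultimately obtain Q where Q: "Q \<in> set (multisets 3 index_pairs)" "mset Q = mset P"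
    using multisets_complete[of P index_pairs] by auto
  obtain C ws where C: "(C, ws) \<in> set standard_slices" and std: "standard Q C"
    using slices_standard Q(1) by (auto simp: list_all_iff list_ex_iff)
  from std obtain w1 where w1: "w1 \<in> set slice_words"
    "mset (transform w1 (map (Pair I1) Q)) = mset (map (Pair I1) C)" and "spread C = spread Q"
    by (auto simp: standard_def list_ex_iff same_iff)
  then have spread_C: "spread C = m w0"
    using spread_cong[OF Q(2)] by (simp add: m_def P_def ts1_def)
  define ts2 where "ts2 = transform w1 ts1"
  have bal2: "balanced ts2" using bal1 by (simp add: ts2_def balanced_transform)
  define us where "us = filter (\<lambda>t. fst t \<noteq> I1) ts2"
  have "mset (filter (\<lambda>t. fst t = I1) ts2) = mset (map (Pair I1) C)"
  proof -
    have "filter (\<lambda>t. fst t = I1) ts2 = transform w1 (filter (\<lambda>t. fst t = I1) ts1)"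
      by (simp add: ts2_def transform_def filter_map comp_def fst_slice_word[OF w1(1)])
    also have "\<dots> = transform w1 (map (Pair I1) P)"
      by (simp add: front_Pair P_def)
    also have "mset \<dots> = mset (transform w1 (map (Pair I1) Q))"
      by (rule mset_transform_cong) (simp add: Q(2))
    finally show ?thesis using w1(2) by simp
  qed
  then have split: "mset ts2 = mset (map (Pair I1) C @ us)"
    unfolding us_def by (metis mset_append mset_filter multiset_partition)
  have len: "length us = 6"
  proof -
    have "length C = length Q" using arg_cong[OF w1(2), of size] by (simp add: transform_def)
    also have "\<dots> = 3" using \<open>length P = 3\<close> Q(2) by (metis size_mset)
    finally have "length C = 3" .
    moreover have "length ts2 = length C + length us"
      using arg_cong[OF split, of size] by simp
    ultimately show ?thesis using length_balanced[OF bal2] by simp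
  qed
  have later: "set us \<subseteq> set later_cells"
  proof
    fix t assume "t \<in> set us"
    then have "fst t \<noteq> I1" by (simp add: us_def)
    then show "t \<in> set later_cells"
      by (cases t; cases "fst t"; cases "fst (snd t)"; cases "snd (snd t)") (auto simp: later_cells_def)
  qed
  have "balanced (map (Pair I1) C @ us)"
    using bal2 balanced_cong[OF split] by simp
  from fillings_complete[OF later len this] obtain zs
    where zs: "zs \<in> set (fillings 6 later_cells (map (Pair I1) C))" "mset zs = mset ts2"
    unfolding split by auto
  have "minimal zs"
  proof -
    have "spread (front zs) \<le> spread (front (transform v zs))" for v
    proof -
      have "mset (transform (w1 @ v) ts1) = mset (transform v zs)"
        unfolding transform_append using zs(2) by (intro mset_transform_cong) (simp add: ts2_def)
      from spread_cong[OF front_cong[OF this]]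
      have *: "spread (front (transform v zs)) = m (w0 @ w1 @ v)"
        by (simp add: m_def ts1_def transform_append)
      have "front (map (Pair I1) C @ us) = C"
        by (simp add: front_def us_def filter_map comp_def)
      then have "spread (front zs) = m w0"
        using spread_cong[OF front_cong[OF trans[OF zs(2) split]]] spread_C by simp
      then show ?thesis using w0 * by simp
    qed
    then show ?thesis by (simp add: minimal_def Let_def)
  qed
  with zs(1) have zs_in: "zs \<in> set (filter minimal (fillings 6 later_cells (map (Pair I1) C)))"
    by simp
  have all2: "list_all2 (covered (map fst table))
     (filter minimal (fillings 6 later_cells (map (Pair I1) C))) ws"
    using standard_slices_covered C by (auto simp: Let_def list_all_iff)
  obtain w2 where "covered (map fst table) zs w2"
    using list_all2_partner[OF all2 zs_in] by (rule exE)
  then have "Bex (fst ` set table) (same (transform w2 zs))"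
    by (simp only: covered_def Let_def list_ex_iff set_map)
  then obtain r q where r: "(r, q) \<in> set table" "mset (transform w2 zs) = mset r"
    unfolding same_iff by force
  have "mset (transform (w0 @ w1 @ w2) ts) = mset (transform w2 zs)"
    unfolding transform_append using zs(2) by (intro mset_transform_cong) (simp add: ts2_def ts1_def)
  then have "mset (transform (w0 @ w1 @ w2) ts) = mset r"
    unfolding r(2) .
  with r(1) show ?thesis by blast
qed

section \<open>Invariants alternate and are supported on fourteen orbits\<close>

lemma cell_coef_exchanged: "cell_coef f ts = cell_coef (relabel exchange12 f) (map exchange12 ts)"
  "cell_coef f ts = cell_coef (relabel exchange23 f) (map exchange23 ts)"
  using cell_coef_exchange(1)[of f "map exchange12 ts"] cell_coef_exchange(2)[of f "map exchange23 ts"]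
  by (simp_all add: comp_def)

lemma invariant_balanced:
  assumes f: "invariant9 f" and nz: "cell_coef f ts \<noteq> 0"
  shows "balanced ts"
proof -
  have first: "occurs fst v us = 3" if "invariant9 g" "cell_coef g us \<noteq> 0" for g us v
  proof -
    have "occurs fst (point v) (map place us) = occurs fst v us"
      by (simp add: occurs_def filter_map comp_def place_def)
    then show ?thesis
      using first_balanced[OF that(1), of "map place us"] that(2) by (simp add: cell_coef_def)
  qed
  have second: "occurs (fst \<circ> snd) v us = 3" if "invariant9 g" "cell_coef g us \<noteq> 0" for g us v
  proof -
    have "fst \<circ> exchange12 = (fst \<circ> snd :: cell \<Rightarrow> idx)" by auto
    then show ?thesis
      using first[OF invariant9_relabel[OF that(1)], of exchange12 "map exchange12 us" v] that
      by (simp add: occurs_map flip: cell_coef_exchanged)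
  qed
  have third: "occurs (snd \<circ> snd) v us = 3" if "invariant9 g" "cell_coef g us \<noteq> 0" for g us v
  proof -
    have "fst \<circ> snd \<circ> exchange23 = (snd \<circ> snd :: cell \<Rightarrow> idx)" by auto
    then show ?thesis
      using second[OF invariant9_relabel[OF that(1)], of exchange23 "map exchange23 us" v] that
      by (simp add: occurs_map flip: cell_coef_exchanged)
  qed
  show ?thesis
    using first second third f nz unfolding balanced_def by blast
qed

lemma balanced_determined:
  assumes "balanced ts"
  shows "\<exists>q. determined ts q"
proof -
  obtain w r q where "(r, q) \<in> set table" "mset (transform w ts) = mset r"
    using balanced_in_table[OF assms] by blast
  then have "determined (transform w ts) q"
    using table_determined determined_cong by blast
  then show ?thesis using determined_untransform by blast
qed

text \<open>
  For interchanges of directions this uses that the coefficient is determined: a single invariant is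
  then compared with itself.
\<close>

lemma cell_coef_move:
  assumes f: "invariant9 f"
  shows "cell_coef f (map (move g) ts) = - cell_coef f ts"
proof (cases "balanced ts")
  case True
  then obtain q where "determined ts q" using balanced_determined by blast
  with determined_move[OF this, of g] f show ?thesis by (simp add: determined_def)
next
  case False
  then have "\<not> balanced (map (move g) ts)"
    using balanced_move[of "map (move g) ts" g] by (auto simp: comp_def)
  then have "cell_coef f (map (move g) ts) = 0" "cell_coef f ts = 0"
    using False invariant_balanced[OF f] by blast+
  then show ?thesis by simp
qed

lemma cell_coef_word: "invariant9 f \<Longrightarrow> cell_coef f (transform w ts) = of_int (parity w) * cell_coef f ts"
proof (induction w arbitrary: ts)
  case (Cons g w)
  then show ?case by (simp add: transform_Cons parity_Cons cell_coef_move)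
qed (simp add: parity_def)

lemma leading_coefficient: "invariant9 f \<Longrightarrow> r \<in> set leading_lists \<Longrightarrow> cell_coef f r = cell_coef f base_list"
  using table_leading(2) table_determined[of r 1] by (auto simp: list_all_iff determined_def)

lemma nonzero_leading:
  assumes f: "invariant9 f" and nz: "cell_coef f ts \<noteq> 0"
  obtains w r where "r \<in> set leading_lists" "mset (transform w ts) = mset r"
proof -
  obtain w r q where r: "(r, q) \<in> set table" "mset (transform w ts) = mset r"
    using balanced_in_table[OF invariant_balanced[OF f nz]] by blast
  have "cell_coef f r \<noteq> 0"
    using nz cell_coef_word[OF f, of w ts] cell_coef_cong[OF r(2), of f] by (auto simp: parity_def split: if_splits)
  then have "q \<noteq> 0"
    using table_determined[OF r(1)] f by (auto simp: determined_def)
  then have "r \<in> set leading_lists"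
    using table_leading(1) r(1) by (auto simp: list_all_iff)
  with r(2) show ?thesis using that by blast
qed

section \<open>Words in the generators and symmetries of arrays\<close>

definition array :: "cell list \<Rightarrow> exponent_array" where
  "array ts = array_of (map place ts)"

lemma bij_place: "bij place"
proof (rule bijI[OF inj_place])
  have "\<exists>t. (a, b, c) = place t" for a b c
  proof -
    obtain i j k where "point i = a" "point j = b" "point k = c" using point_surj by metis
    then show ?thesis by (intro exI[of _ "(i, j, k)"]) (simp add: place_def)
  qed
  then show "surj place" unfolding surj_def by auto
qed

lemma array_place: "array ts (point i) (point j) (point k) = count_list ts (i, j, k)"
proof -
  have "(point i, point j, point k) = place (i, j, k)" by (simp add: place_def)
  then show ?thesis by (simp add: array_def array_of_def count_list_map_inj[OF inj_place])
qed

lemma array_eqI: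
  assumes "\<And>i j k. A (point i) (point j) (point k) = B (point i) (point j) (point k)"
  shows "A = (B :: exponent_array)"
proof (intro ext)
  fix a b c
  show "A a b c = B a b c" using assms point_surj by metis
qed

lemma array_eq_iff: "array ts = array us \<longleftrightarrow> mset ts = mset us"
proof
  assume "array ts = array us"
  then have "count_list ts t = count_list us t" for t
    using array_place[of ts "fst t" "fst (snd t)" "snd (snd t)"]
      array_place[of us "fst t" "fst (snd t)" "snd (snd t)"] by simp
  then show "mset ts = mset us"
    by (intro multiset_eqI) (simp add: count_mset)
next
  assume "mset ts = mset us"
  then have "count_list ts t = count_list us t" for t
    by (metis count_mset)
  then show "array ts = array us"
    by (intro array_eqI) (simp add: array_place)
qed

lemma array_surj: obtains ts where "A = array ts"
proof -
  have fin: "finite (UNIV :: cell set)"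
    using bij_betw_finite[OF bij_place] by simp
  define M where "M = (\<Sum>(i, j, k)\<in>UNIV. replicate_mset (A (point i) (point j) (point k)) (i, j, k))"
  obtain ts where ts: "mset ts = M" using ex_mset by blast
  have "count M (i, j, k) = (\<Sum>t\<in>UNIV. if t = (i, j, k) then A (point i) (point j) (point k) else 0)" for i j k
    unfolding M_def count_sum by (rule sum.cong) (auto simp: case_prod_beta)
  then have "count M (i, j, k) = A (point i) (point j) (point k)" for i j k
    using fin by simp
  then have "A = array ts"
    by (intro array_eqI) (simp add: array_place flip: count_mset add: ts)
  then show ?thesis by (rule that)
qed

lemma monomial_of_array: "monomial_of (array ts) = Poly_Mapping.single (mon (map place ts)) 1"
proof -
  have "monomial_of (array ts) = prod_list (map X (map place ts))"
    unfolding array_def monomial_of_array_of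
    by (intro arg_cong[of _ _ prod_list] map_cong) (auto simp: var_eq_X)
  then show ?thesis by (simp only: prod_list_X)
qed

lemma inj_monomial_of: "inj monomial_of"
proof (rule injI)
  fix A B assume eq: "monomial_of A = monomial_of B"
  obtain ts us where "A = array ts" "B = array us" using array_surj by metis
  moreover from this eq have "coef (monomial_of A) (map place us) = 1"
    by (simp add: monomial_of_array coef_single)
  ultimately show "A = B"
    by (auto simp: monomial_of_array coef_single array_eq_iff inj_map_eq_map
        multiset.inj_map[OF inj_place, THEN inj_eq] split: if_splits)
qed

lemma cell_coef_monomial_of: "cell_coef (monomial_of A) ts = (if A = array ts then 1 else 0)"
proof -
  obtain us where A: "A = array us" by (rule array_surj)
  show ?thesis
    unfolding A array_eq_iff cell_coef_def monomial_of_array coef_single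
    by (simp add: multiset.inj_map[OF inj_place, THEN inj_eq])
qed

lemma cell_coef_eqI: "(\<And>ts. cell_coef f ts = cell_coef g ts) \<Longrightarrow> f = g"
proof (rule array_poly_eqI)
  fix ts assume "\<And>ts. cell_coef f ts = cell_coef g ts"
  moreover have "map place (map (inv place) ts) = ts"
    by (simp add: surj_f_inv_f[OF bij_is_surj[OF bij_place]] comp_def)
  ultimately show "coef f ts = coef g ts" unfolding cell_coef_def by metis
qed

lemma inj_move: "inj (move g)"
  by (metis injI move_involution)

lemma count_list_move: "count_list (map (move g) us) t = count_list us (move g t)"
  using count_list_map_inj[OF inj_move, of g us "move g t"] by simp

lemma transpose_point:
  "Transposition.transpose 1 2 (point i) = point (swap12 i)"
  "Transposition.transpose 1 3 (point i) = point (swap13 i)"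
  "Transposition.transpose 2 3 (point i) = point (swap23 i)"
  by (cases i; simp add: Transposition.transpose_def)+

lemma permute_directions_transpose:
  "permute_directions (Transposition.transpose 1 2) E = (\<lambda>i j k. E j i k)"
  "permute_directions (Transposition.transpose 1 3) E = (\<lambda>i j k. E k j i)"
  "permute_directions (Transposition.transpose 2 3) E = (\<lambda>i j k. E i k j)"
  by (simp_all add: permute_directions_def Transposition.transpose_def)

lemma permute_directions_comp:
  "permute_directions (p \<circ> q) = permute_directions p \<circ> permute_directions q"
proof (intro ext)
  fix E t1 t2 t3
  show "permute_directions (p \<circ> q) E t1 t2 t3 = (permute_directions p \<circ> permute_directions q) E t1 t2 t3"
    using exhaust_3[of "q 1"] exhaust_3[of "q 2"] exhaust_3[of "q 3"]
    by (elim disjE) (simp_all add: permute_directions_def Let_def)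
qed

lemma array_move_symmetry:
  "array (map (move X12) us) = permute_entries (Transposition.transpose 1 2) id id (array us)"
  "array (map (move X13) us) = permute_entries (Transposition.transpose 1 3) id id (array us)"
  "array (map (move X23) us) = permute_entries (Transposition.transpose 2 3) id id (array us)"
  "array (map (move Y12) us) = permute_entries id (Transposition.transpose 1 2) id (array us)"
  "array (map (move Y13) us) = permute_entries id (Transposition.transpose 1 3) id (array us)"
  "array (map (move Y23) us) = permute_entries id (Transposition.transpose 2 3) id (array us)"
  "array (map (move Z12) us) = permute_entries id id (Transposition.transpose 1 2) (array us)"
  "array (map (move Z13) us) = permute_entries id id (Transposition.transpose 1 3) (array us)"
  "array (map (move Z23) us) = permute_entries id id (Transposition.transpose 2 3) (array us)"
  "array (map (move D12) us) = permute_directions (Transposition.transpose 1 2) (array us)"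
  "array (map (move D13) us) = permute_directions (Transposition.transpose 1 3) (array us)"
  "array (map (move D23) us) = permute_directions (Transposition.transpose 2 3) (array us)"
  by (rule array_eqI, simp add: count_list_move permute_entries_def permute_directions_transpose
      transpose_point array_place)+

lemma transpositions_3:
  fixes a b :: 3
  assumes "a \<noteq> b"
  shows "Transposition.transpose a b \<in>
    {Transposition.transpose 1 2, Transposition.transpose 1 3, Transposition.transpose 2 3}"
  using assms exhaust_3[of a] exhaust_3[of b] by (auto simp: transpose_commute)

text \<open>
  A sign rule for an action \<open>K\<close> of the permutations of three points has to be checked on transpositions
  only.  The action may be a left or a right action, as permutations of entries and of directions
  differ in this respect.
\<close>

lemma permutation_3_induct:
  fixes K :: "(3 \<Rightarrow> 3) \<Rightarrow> exponent_array \<Rightarrow> exponent_array"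
  assumes p: "p permutes UNIV"
    and id: "K id = id"
    and comp: "\<And>p q. K (p \<circ> q) = K p \<circ> K q \<or> K (p \<circ> q) = K q \<circ> K p"
    and Q_id: "Q id 1"
    and Q_comp: "\<And>H H' s s'. Q H s \<Longrightarrow> Q H' s' \<Longrightarrow> Q (H \<circ> H') (s * s')"
    and Q_transpose: "Q (K (Transposition.transpose 1 2)) (- 1)"
      "Q (K (Transposition.transpose 1 3)) (- 1)" "Q (K (Transposition.transpose 2 3)) (- 1)"
  shows "Q (K p) (sign p)"
  using p finite_class.finite_UNIV
proof (induction rule: permutes_induct)
  case id
  show ?case using Q_id unfolding assms(2) sign_id .
next
  case (swap a b p)
  have "sign (Transposition.transpose a b \<circ> p) = - sign p"
    using swap by (simp add: sign_compose permutation_swap_id sign_swap_id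
        permutes_imp_permutation[OF finite_class.finite_UNIV])
  moreover have step: "Q (K (Transposition.transpose a b)) (- 1)"
    using transpositions_3[OF \<open>a \<noteq> b\<close>] Q_transpose by auto
  have "Q (K (Transposition.transpose a b) \<circ> K p) (- sign p)"
    "Q (K p \<circ> K (Transposition.transpose a b)) (- sign p)"
    using Q_comp[OF step swap.IH] Q_comp[OF swap.IH step] by simp_all
  ultimately show ?case
    using comp[of "Transposition.transpose a b" p] by (elim disjE) (simp_all only:)
qed

text \<open>
  With \<open>s\<close> the sign of the symmetry \<open>H\<close>, this reduces statements about the quadruples of permutations in
  \<open>symmetries\<close> to statements about the generators.
\<close>

definition realised :: "(exponent_array \<Rightarrow> exponent_array) \<Rightarrow> int \<Rightarrow> bool" where
  "realised H s \<longleftrightarrow> (\<exists>w. parity w = s \<and> (\<forall>ts. H (array ts) = array (transform w ts)))"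

lemma realised_id: "realised id 1"
  unfolding realised_def by (intro exI[of _ "[]"]) (simp add: parity_def)

lemma realised_comp: "realised H s \<Longrightarrow> realised H' s' \<Longrightarrow> realised (H \<circ> H') (s * s')"
proof -
  assume "realised H s" "realised H' s'"
  then obtain v w where "parity v = s" "parity w = s'"
    "\<And>ts. H (array ts) = array (transform v ts)" "\<And>ts. H' (array ts) = array (transform w ts)"
    by (auto simp: realised_def)
  then show ?thesis
    unfolding realised_def
    by (intro exI[of _ "w @ v"]) (auto simp: transform_append parity_def)
qed

lemma realised_move:
  assumes "\<And>ts. array (map (move g) ts) = H (array ts)"
  shows "realised H (- 1)"
  unfolding realised_def
  by (intro exI[of _ "[g]"]) (simp add: parity_def transform_Cons assms)

lemmas realised_transpositions = array_move_symmetry[THEN realised_move]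

lemma realised_symmetry:
  assumes "g \<in> symmetries"
  shows "realised (permute_array g) (symmetry_sign g)"
proof -
  obtain \<alpha> \<beta> \<gamma> \<delta> where g: "g = (\<alpha>, \<beta>, \<gamma>, \<delta>)" by (metis prod.collapse)
  then have p: "\<alpha> permutes UNIV" "\<beta> permutes UNIV" "\<gamma> permutes UNIV" "\<delta> permutes UNIV"
    using assms by (auto simp: symmetries_def)
  note induct = permutation_3_induct[where Q = realised, OF _ _ _ realised_id realised_comp]
  have a: "realised (permute_entries \<alpha> id id) (sign \<alpha>)"
    by (rule induct[where K = "\<lambda>p. permute_entries p id id", OF p(1)])
      (auto simp: permute_entries_def fun_eq_iff intro: realised_transpositions)
  have b: "realised (permute_entries id \<beta> id) (sign \<beta>)"
    by (rule induct[where K = "\<lambda>p. permute_entries id p id", OF p(2)])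
      (auto simp: permute_entries_def fun_eq_iff intro: realised_transpositions)
  have c: "realised (permute_entries id id \<gamma>) (sign \<gamma>)"
    by (rule induct[where K = "\<lambda>p. permute_entries id id p", OF p(3)])
      (auto simp: permute_entries_def fun_eq_iff intro: realised_transpositions)
  have d: "realised (permute_directions \<delta>) (sign \<delta>)"
  proof (rule induct[where K = permute_directions, OF p(4)])
    show "permute_directions id = id"
      by (simp add: permute_directions_def fun_eq_iff Let_def)
  qed (auto simp: permute_directions_comp intro: realised_transpositions)
  have "permute_array g = permute_entries \<alpha> id id \<circ> (permute_entries id \<beta> id \<circ>
      (permute_entries id id \<gamma> \<circ> permute_directions \<delta>))"
    by (simp add: g fun_eq_iff permute_entries_def)
  moreover have "symmetry_sign g = sign \<alpha> * (sign \<beta> * (sign \<gamma> * sign \<delta>))"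
    by (simp add: g)
  ultimately show ?thesis
    using realised_comp[OF a realised_comp[OF b realised_comp[OF c d]]] by simp
qed

section \<open>Alternating orbit sums\<close>

text \<open>
  Composition with \<open>H\<close> permutes the action maps of the group \<open>G\<close>.  This captures that \<open>H\<close> acts as an element
  of \<open>G\<close> without a multiplication of the quadruples that represent the elements of \<open>G\<close>.
\<close>

definition translation :: "(exponent_array \<Rightarrow> exponent_array) \<Rightarrow> bool" where
  "translation H \<longleftrightarrow> inj H \<and> (\<exists>\<rho>. bij_betw \<rho> symmetries symmetries \<and>
     (\<forall>g\<in>symmetries. \<forall>E. permute_array (\<rho> g) E = H (permute_array g E)))"

lemma translation_id: "translation id"
  unfolding translation_def by (intro conjI exI[of _ id]) (auto simp: bij_betw_def)

lemma translation_comp: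
  assumes "translation H" "translation H'"
  shows "translation (H \<circ> H')"
proof -
  obtain \<rho> where r: "bij_betw \<rho> symmetries symmetries"
    "\<And>g E. g \<in> symmetries \<Longrightarrow> permute_array (\<rho> g) E = H (permute_array g E)"
    using assms(1) by (auto simp: translation_def)
  obtain \<rho>' where r': "bij_betw \<rho>' symmetries symmetries"
    "\<And>g E. g \<in> symmetries \<Longrightarrow> permute_array (\<rho>' g) E = H' (permute_array g E)"
    using assms(2) by (auto simp: translation_def)
  have "permute_array ((\<rho> \<circ> \<rho>') g) E = (H \<circ> H') (permute_array g E)" if "g \<in> symmetries" for g E
    using that r(2)[of "\<rho>' g"] r'(2) bij_betwE[OF r'(1)] by simp
  moreover have "inj (H \<circ> H')"
    using assms by (auto simp: translation_def intro: inj_compose)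
  ultimately show ?thesis
    unfolding translation_def using bij_betw_trans[OF r'(1) r(1)] by blast
qed

lemma translation_entries:
  assumes p: "a permutes UNIV" "b permutes UNIV" "c permutes UNIV"
  shows "translation (permute_entries a b c)"
proof -
  have "inj (permute_entries a b c)"
  proof (rule inj_on_inverseI)
    fix E show "permute_entries (inv a) (inv b) (inv c) (permute_entries a b c E) = E"
      by (simp add: permute_entries_def permutes_inverses[OF p(1)] permutes_inverses[OF p(2)]
          permutes_inverses[OF p(3)])
  qed
  moreover have "bij_betw (\<lambda>(\<alpha>, \<beta>, \<gamma>, \<delta>). (\<alpha> \<circ> a, \<beta> \<circ> b, \<gamma> \<circ> c, \<delta>)) symmetries symmetries"
    by (rule bij_betw_byWitness[where f' = "\<lambda>(\<alpha>, \<beta>, \<gamma>, \<delta>). (\<alpha> \<circ> inv a, \<beta> \<circ> inv b, \<gamma> \<circ> inv c, \<delta>)"])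
      (auto simp: symmetries_def comp_assoc permutes_inv_o[OF p(1)] permutes_inv_o[OF p(2)]
        permutes_inv_o[OF p(3)] intro!: permutes_compose permutes_inv p)
  ultimately show ?thesis
    unfolding translation_def
    by (intro conjI exI[of _ "\<lambda>(\<alpha>, \<beta>, \<gamma>, \<delta>). (\<alpha> \<circ> a, \<beta> \<circ> b, \<gamma> \<circ> c, \<delta>)"])
      (auto simp: permute_entries_def)
qed

lemma translation_involution:
  assumes invol: "\<And>E. H (H E) = E" and "\<And>g. \<sigma> (\<sigma> g) = g"
    and "\<And>g. g \<in> symmetries \<Longrightarrow> \<sigma> g \<in> symmetries"
    and "\<And>g E. permute_array (\<sigma> g) E = H (permute_array g E)"
  shows "translation H"
proof -
  have "inj H" by (metis injI invol)
  moreover have "bij_betw \<sigma> symmetries symmetries"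
    by (rule bij_betw_byWitness[where f' = \<sigma>]) (use assms(2,3) in auto)
  ultimately show ?thesis
    unfolding translation_def using assms(4) by blast
qed

text \<open>
  Interchanging two directions after an element of \<open>G\<close> amounts to interchanging two of its three
  permutations of values and composing its permutation of directions with the transposition.
\<close>

lemma translation_directions_transpose:
  "translation (permute_directions (Transposition.transpose 1 2))"
  "translation (permute_directions (Transposition.transpose 1 3))"
  "translation (permute_directions (Transposition.transpose 2 3))"
proof -
  have tt: "Transposition.transpose a b \<circ> (Transposition.transpose a b \<circ> \<delta>) = \<delta>" for a b :: 3 and \<delta> :: "3 \<Rightarrow> 3"
    by (simp add: fun_eq_iff)
  have perm: "\<delta> permutes UNIV \<Longrightarrow> Transposition.transpose a b \<circ> \<delta> permutes UNIV" for a b :: 3 and \<delta>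
    by (intro permutes_compose permutes_swap_id) auto
  note [simp] = permute_directions_comp permute_directions_transpose
  show "translation (permute_directions (Transposition.transpose 1 2))"
    by (rule translation_involution[where \<sigma> = "\<lambda>(\<alpha>, \<beta>, \<gamma>, \<delta>). (\<beta>, \<alpha>, \<gamma>, Transposition.transpose 1 2 \<circ> \<delta>)"])
      (auto simp: tt symmetries_def perm permute_entries_def)
  show "translation (permute_directions (Transposition.transpose 1 3))"
    by (rule translation_involution[where \<sigma> = "\<lambda>(\<alpha>, \<beta>, \<gamma>, \<delta>). (\<gamma>, \<beta>, \<alpha>, Transposition.transpose 1 3 \<circ> \<delta>)"])
      (auto simp: tt symmetries_def perm permute_entries_def)
  show "translation (permute_directions (Transposition.transpose 2 3))"
    by (rule translation_involution[where \<sigma> = "\<lambda>(\<alpha>, \<beta>, \<gamma>, \<delta>). (\<alpha>, \<gamma>, \<beta>, Transposition.transpose 2 3 \<circ> \<delta>)"])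
      (auto simp: tt symmetries_def perm permute_entries_def)
qed

lemma translation_symmetry:
  assumes "g \<in> symmetries"
  shows "translation (permute_array g)"
proof -
  obtain \<alpha> \<beta> \<gamma> \<delta> where g: "g = (\<alpha>, \<beta>, \<gamma>, \<delta>)" by (metis prod.collapse)
  then have p: "\<alpha> permutes UNIV" "\<beta> permutes UNIV" "\<gamma> permutes UNIV" "\<delta> permutes UNIV"
    using assms by (auto simp: symmetries_def)
  have "translation (permute_directions \<delta>)"
  proof (rule permutation_3_induct[where Q = "\<lambda>H s. translation H" and K = permute_directions, OF p(4)])
    show "permute_directions id = id"
      by (simp add: permute_directions_def fun_eq_iff Let_def)
  qed (auto simp: permute_directions_comp intro: translation_id translation_comp translation_directions_transpose)
  moreover have "permute_array g = permute_entries \<alpha> \<beta> \<gamma> \<circ> permute_directions \<delta>"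
    by (simp add: g fun_eq_iff)
  ultimately show ?thesis
    using translation_comp[OF translation_entries[OF p(1-3)]] by simp
qed

lemma translation_move: "\<exists>H. translation H \<and> (\<forall>us. array (map (move g) us) = H (array us))"
proof -
  have t: "Transposition.transpose a b permutes UNIV" for a b :: 3
    by (rule permutes_swap_id) auto
  note tr = translation_entries[OF t permutes_id permutes_id]
    translation_entries[OF permutes_id t permutes_id]
    translation_entries[OF permutes_id permutes_id t] translation_directions_transpose
  show ?thesis
    by (cases g) (use tr array_move_symmetry in blast)+
qed

definition array_orbit :: "exponent_array \<Rightarrow> exponent_array set" where
  "array_orbit E = (\<lambda>g. permute_array g E) ` symmetries"

lemma array_orbit_self: "E \<in> array_orbit E"
proof -
  have "(id, id, id, id) \<in> symmetries" by (simp add: symmetries_def permutes_id)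
  moreover have "permute_array (id, id, id, id) E = E"
    by (simp add: permute_entries_def permute_directions_def)
  ultimately show ?thesis unfolding array_orbit_def by force
qed

lemma array_orbit_translation:
  assumes "translation H" "F \<in> array_orbit E"
  shows "H F \<in> array_orbit E"
proof -
  obtain \<rho> where r: "bij_betw \<rho> symmetries symmetries"
    "\<And>g E. g \<in> symmetries \<Longrightarrow> permute_array (\<rho> g) E = H (permute_array g E)"
    using assms(1) by (auto simp: translation_def)
  from assms(2) obtain g where "g \<in> symmetries" "F = permute_array g E"
    by (auto simp: array_orbit_def)
  then have "\<rho> g \<in> symmetries" "permute_array (\<rho> g) E = H F"
    using r(2) bij_betwE[OF r(1)] by auto
  then show ?thesis
    unfolding array_orbit_def using imageI[of "\<rho> g" symmetries "\<lambda>g. permute_array g E"] by simp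
qed

lemma array_orbit_transform:
  "array (transform w ts) \<in> array_orbit E \<Longrightarrow> array ts \<in> array_orbit E"
proof (induction w arbitrary: ts)
  case (Cons g w)
  then have *: "array (map (move g) ts) \<in> array_orbit E" by (simp add: transform_Cons)
  obtain H where H: "translation H" "\<And>us. array (map (move g) us) = H (array us)"
    using translation_move by blast
  have "array ts = H (array (map (move g) ts))"
    using H(2)[of "map (move g) ts"] by (simp add: comp_def)
  then show ?case using array_orbit_translation[OF H(1) *] by simp
qed simp

text \<open>
  The orbit-stabilizer theorem.  Translations carry the fibres of the orbit map bijectively onto each
  other.
\<close>

lemma card_fibre:
  assumes "F \<in> array_orbit E"
  shows "card (array_orbit E) * card {g \<in> symmetries. permute_array g E = F} = card symmetries"
proof -
  let ?n = "\<lambda>F. card {g \<in> symmetries. permute_array g E = F}"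
  have translated: "?n (H F) = ?n F" if H: "translation H" for H F
  proof -
    obtain \<rho> where r: "bij_betw \<rho> symmetries symmetries"
      "\<And>g E. g \<in> symmetries \<Longrightarrow> permute_array (\<rho> g) E = H (permute_array g E)" and "inj H"
      using H by (auto simp: translation_def)
    have "{g \<in> symmetries. permute_array g E = H F} = \<rho> ` {g \<in> symmetries. permute_array g E = F}"
    proof (intro set_eqI iffI)
      fix g assume g: "g \<in> {g \<in> symmetries. permute_array g E = H F}"
      then obtain g' where g': "g' \<in> symmetries" "g = \<rho> g'"
        using bij_betw_imp_surj_on[OF r(1)] by blast
      then have "H (permute_array g' E) = H F"
        using r(2)[of g' E] g by simp
      then have "permute_array g' E = F"
        using \<open>inj H\<close> by (simp add: inj_eq)
      with g' show "g \<in> \<rho> ` {g \<in> symmetries. permute_array g E = F}" by blast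
    next
      fix g assume "g \<in> \<rho> ` {g \<in> symmetries. permute_array g E = F}"
      then obtain g' where "g' \<in> symmetries" "permute_array g' E = F" "g = \<rho> g'" by blast
      then show "g \<in> {g \<in> symmetries. permute_array g E = H F}"
        using r(2)[of g' E] bij_betwE[OF r(1)] by simp
    qed
    moreover have "inj_on \<rho> {g \<in> symmetries. permute_array g E = F}"
      by (rule inj_on_subset[OF bij_betw_imp_inj_on[OF r(1)]]) simp
    ultimately show ?thesis by (simp add: card_image)
  qed
  have const: "?n F' = ?n E" if F': "F' \<in> array_orbit E" for F'
  proof -
    obtain h where "h \<in> symmetries" "F' = permute_array h E"
      using F' unfolding array_orbit_def by blast
    with translated[OF translation_symmetry] show ?thesis by simp
  qed
  have "card symmetries = (\<Sum>F'\<in>array_orbit E. ?n F')"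
    using sum.image_gen[of symmetries "\<lambda>_. 1 :: nat" "\<lambda>g. permute_array g E"]
    by (simp add: array_orbit_def)
  also have "\<dots> = card (array_orbit E) * ?n E"
    by (simp add: const)
  finally show ?thesis using const[OF assms] by simp
qed

lemma of_int_const: "of_int k = const (of_int k)"
proof -
  have nat: "of_nat n = const (of_nat n)" for n
    by (induction n) (simp_all add: const_add)
  have neg: "const (- c) = - const c" for c
    by (simp add: const_def single_uminus)
  show ?thesis by (cases k) (simp_all add: nat neg flip: of_nat_Suc)
qed

lemma cell_coef_const_mult: "cell_coef (const c * p) ts = c * cell_coef p ts"
  and cell_coef_sum: "cell_coef (sum g I) ts = (\<Sum>i\<in>I. cell_coef (g i) ts)"
  and cell_coef_add: "cell_coef (p + p') ts = cell_coef p ts + cell_coef p' ts"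
  and cell_coef_0: "cell_coef 0 ts = 0"
  by (simp_all add: cell_coef_def coef_const_mult coef_sum coef_add)

text \<open>
  For \<open>g\<close> with \<open>g E = F\<close> the product of the sign of \<open>g\<close> and the coefficient of \<open>f\<close> at \<open>E\<close> is the coefficient
  at \<open>F\<close>, independently of \<open>g\<close>.  The number of such \<open>g\<close> cancels the normalizing factor of the
  alternating orbit sum.
\<close>

lemma cell_coef_alternating_orbit_sum:
  assumes f: "invariant9 f"
  shows "cell_coef f r * cell_coef (alternating_orbit_sum (array r)) ts
    = (if array ts \<in> array_orbit (array r) then cell_coef f ts else 0)"
proof -
  let ?E = "array r" and ?F = "array ts"
  let ?fib = "{g \<in> symmetries. permute_array g ?E = ?F}"
  have sign: "of_int (symmetry_sign g) * cell_coef f r = cell_coef f ts" if g: "g \<in> ?fib" for g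
  proof -
    obtain w where "parity w = symmetry_sign g" "permute_array g ?E = array (transform w r)"
      using realised_symmetry[of g] g by (auto simp: realised_def)
    moreover from this g have "cell_coef f ts = cell_coef f (transform w r)"
      by (intro cell_coef_cong) (simp add: array_eq_iff)
    ultimately show ?thesis using cell_coef_word[OF f] by simp
  qed
  have fin: "finite symmetries" by simp
  have "(\<Sum>g\<in>symmetries. of_int (symmetry_sign g) * cell_coef (monomial_of (permute_array g ?E)) ts)
      = (\<Sum>g\<in>?fib. of_int (symmetry_sign g))"
    unfolding cell_coef_monomial_of sum.inter_filter[OF fin] by (rule sum.cong) auto
  then have "cell_coef (alternating_orbit_sum ?E) ts
      = of_nat (card (monomial_orbit ?E)) / of_nat (card symmetries) * (\<Sum>g\<in>?fib. of_int (symmetry_sign g))"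
    by (simp add: alternating_orbit_sum_def cell_coef_const_mult cell_coef_sum of_int_const)
  then have "cell_coef f r * cell_coef (alternating_orbit_sum ?E) ts
      = of_nat (card (monomial_orbit ?E)) / of_nat (card symmetries) * (\<Sum>g\<in>?fib. of_int (symmetry_sign g) * cell_coef f r)"
    unfolding sum_distrib_right[symmetric] by (simp only: mult_ac)
  also have "(\<Sum>g\<in>?fib. of_int (symmetry_sign g) * cell_coef f r) = of_nat (card ?fib) * cell_coef f ts"
    by (simp add: sign)
  also have "card (monomial_orbit ?E) = card (array_orbit ?E)"
  proof -
    have "monomial_orbit ?E = monomial_of ` array_orbit ?E"
      unfolding monomial_orbit_def array_orbit_def image_image by (rule Setcompr_eq_image)
    then show ?thesis
      by (simp add: card_image inj_on_subset[OF inj_monomial_of])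
  qed
  finally have eq: "cell_coef f r * cell_coef (alternating_orbit_sum ?E) ts
      = of_nat (card (array_orbit ?E) * card ?fib) / of_nat (card symmetries) * cell_coef f ts"
    by simp
  show ?thesis
  proof (cases "?F \<in> array_orbit ?E")
    case True
    have "card symmetries \<noteq> 0"
      using True fin by (auto simp: array_orbit_def)
    then show ?thesis
      unfolding eq card_fibre[OF True] using True by simp
  next
    case False
    have "g \<notin> ?fib" for g
    proof
      assume "g \<in> ?fib"
      then have "g \<in> symmetries" "permute_array g ?E = ?F" by simp_all
      then have "?F \<in> array_orbit ?E"
        unfolding array_orbit_def using imageI[of g symmetries "\<lambda>g. permute_array g ?E"] by simp
      with False show False by simp
    qed
    then have "?fib = {}" by blast
    then show ?thesis unfolding eq using False by simp
  qed
qed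

section \<open>The fourteen orbits are distinct\<close>

definition differ :: "cell \<Rightarrow> cell \<Rightarrow> bool" where
  "differ s t \<longleftrightarrow> fst s \<noteq> fst t \<and> fst (snd s) \<noteq> fst (snd t) \<and> snd (snd s) \<noteq> snd (snd t)"

definition degree_in :: "cell list \<Rightarrow> cell \<Rightarrow> nat" where
  "degree_in ts t = length (filter (differ t) ts)"

text \<open>
  The number of walks of length 3 in the graph whose vertices are the nine entries of the list and whose
  edges join entries that differ in all three indices.  The symmetries preserve this graph.
\<close>

definition walks :: "cell list \<Rightarrow> nat" where
  "walks ts = (\<Sum>t\<leftarrow>ts. \<Sum>u\<leftarrow>ts. if differ t u then degree_in ts t * degree_in ts u else 0)"

lemma walks_leading: "distinct (map walks leading_lists)"
  by code_simp

lemma walks_cong: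
  assumes "mset ts = mset us"
  shows "walks ts = walks us"
proof -
  have deg: "degree_in ts = degree_in us"
    by (intro ext) (metis degree_in_def mset_filter size_mset assms)
  show ?thesis
    unfolding walks_def deg sum_mset_sum_list[symmetric] mset_map assms by (rule refl)
qed

lemma differ_move: "differ (move g s) (move g t) \<longleftrightarrow> differ s t"
proof -
  have "swap12 i = swap12 j \<longleftrightarrow> i = j" "swap13 i = swap13 j \<longleftrightarrow> i = j" "swap23 i = swap23 j \<longleftrightarrow> i = j" for i j
    by (cases i; cases j; simp)+
  then show ?thesis by (cases s; cases t; cases g) (auto simp: differ_def)
qed

lemma walks_transform: "walks (transform w ts) = walks ts"
proof -
  have differ: "differ (fold move w s) (fold move w t) = differ s t" for s t
    by (induction w arbitrary: s t) (simp_all add: differ_move)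
  then have "degree_in (map (fold move w) ts) (fold move w t) = degree_in ts t" for t
    by (simp add: degree_in_def filter_map comp_def)
  with differ show ?thesis
    by (simp add: walks_def transform_def comp_def cong: if_cong)
qed

lemma walks_orbit: "array ts \<in> array_orbit (array r) \<Longrightarrow> walks ts = walks r"
proof -
  assume "array ts \<in> array_orbit (array r)"
  then obtain w where "array ts = array (transform w r)"
    using realised_symmetry by (fastforce simp: array_orbit_def realised_def)
  then show "walks ts = walks r"
    using walks_cong[of ts "transform w r"] by (simp add: array_eq_iff walks_transform)
qed

section \<open>The invariant as a sum of alternating orbit sums\<close>

lemma sum_list_single:
  fixes c :: "'b :: comm_monoid_add"
  assumes "distinct xs" "x \<in> set xs"
  shows "(\<Sum>y\<leftarrow>xs. if y = x then c else 0) = c"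
  using assms by (subst sum_list_distinct_conv_sum_set) auto

theorem invariant_expansion:
  assumes f: "invariant9 f"
  shows "f = const (cell_coef f base_list) * (\<Sum>r\<leftarrow>leading_lists. alternating_orbit_sum (array r))"
proof (rule cell_coef_eqI)
  fix ts
  let ?in = "\<lambda>r. array ts \<in> array_orbit (array r)"
  have "cell_coef (\<Sum>r\<leftarrow>rs. alternating_orbit_sum (array r)) ts
      = (\<Sum>r\<leftarrow>rs. cell_coef (alternating_orbit_sum (array r)) ts)" for rs
    by (induction rs) (simp_all add: cell_coef_add cell_coef_0)
  then have "cell_coef (const (cell_coef f base_list) * (\<Sum>r\<leftarrow>leading_lists. alternating_orbit_sum (array r))) ts
      = (\<Sum>r\<leftarrow>leading_lists. cell_coef f base_list * cell_coef (alternating_orbit_sum (array r)) ts)"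
    by (simp add: cell_coef_const_mult sum_list_const_mult)
  also have "\<dots> = (\<Sum>r\<leftarrow>leading_lists. if ?in r then cell_coef f ts else 0)"
  proof (intro arg_cong[of _ _ sum_list] map_cong refl)
    fix r assume "r \<in> set leading_lists"
    from leading_coefficient[OF f this] cell_coef_alternating_orbit_sum[OF f, of r ts]
    show "cell_coef f base_list * cell_coef (alternating_orbit_sum (array r)) ts = (if ?in r then cell_coef f ts else 0)"
      by simp
  qed
  also have "\<dots> = cell_coef f ts"
  proof (cases "cell_coef f ts = 0")
    case True
    then show ?thesis by (simp cong: if_cong)
  next
    case False
    then obtain w r where r: "r \<in> set leading_lists" "mset (transform w ts) = mset r"
      by (rule nonzero_leading[OF f])
    from r(2) have "array (transform w ts) = array r"
      unfolding array_eq_iff .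
    then have "array (transform w ts) \<in> array_orbit (array r)"
      using array_orbit_self[of "array r"] by simp
    then have r_in: "?in r" by (rule array_orbit_transform)
    have "?in s \<longleftrightarrow> s = r" if s: "s \<in> set leading_lists" for s
      using walks_orbit[of ts s] walks_orbit[OF r_in] r_in s r(1) walks_leading
      by (metis distinct_map inj_onD)
    then have "(\<Sum>s\<leftarrow>leading_lists. if ?in s then cell_coef f ts else 0) = (\<Sum>s\<leftarrow>leading_lists. if s = r then cell_coef f ts else 0)"
      by (intro arg_cong[of _ _ sum_list] map_cong refl) auto
    also have "\<dots> = cell_coef f ts"
      using walks_leading r(1) by (intro sum_list_single) (simp_all add: distinct_map)
    finally show ?thesis .
  qed
  finally show "cell_coef f ts = cell_coef (const (cell_coef f base_list) * (\<Sum>r\<leftarrow>leading_lists. alternating_orbit_sum (array r))) ts" ..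
qed

theorem theorem4p4:
  fixes f :: array_poly
  assumes "homogeneous_of_degree 9 f"
    and "SL3_invariant f"
  shows "\<exists>c. f = const c *
      (  alternating_orbit_sum (array_of [(1,2,3), (1,3,2), (1,3,3), (2,1,3), (2,2,1), (2,3,2), (3,1,1), (3,1,1), (3,2,2)])
       + alternating_orbit_sum (array_of [(1,2,3), (1,3,2), (1,3,3), (2,1,3), (2,2,1), (2,3,1), (3,1,2), (3,1,2), (3,2,1)])
       + alternating_orbit_sum (array_of [(1,2,3), (1,3,2), (1,3,3), (2,1,3), (2,2,1), (2,2,2), (3,1,1), (3,1,2), (3,3,1)])
       + alternating_orbit_sum (array_of [(1,2,3), (1,3,2), (1,3,3), (2,1,3), (2,2,1), (2,2,1), (3,1,1), (3,1,2), (3,3,2)])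
       + alternating_orbit_sum (array_of [(1,2,3), (1,3,2), (1,3,3), (2,1,2), (2,2,3), (2,3,1), (3,1,1), (3,1,2), (3,2,1)])
       + alternating_orbit_sum (array_of [(1,2,3), (1,3,2), (1,3,3), (2,1,2), (2,2,2), (2,3,1), (3,1,1), (3,1,1), (3,2,3)])
       + alternating_orbit_sum (array_of [(1,2,3), (1,3,2), (1,3,3), (2,1,2), (2,2,1), (2,3,2), (3,1,1), (3,1,3), (3,2,1)])
       + alternating_orbit_sum (array_of [(1,2,3), (1,3,2), (1,3,3), (2,1,2), (2,2,1), (2,3,1), (3,1,1), (3,1,3), (3,2,2)])
       + alternating_orbit_sum (array_of [(1,2,3), (1,3,2), (1,3,3), (2,1,2), (2,1,3), (2,2,1), (3,1,2), (3,2,1), (3,3,1)])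
       + alternating_orbit_sum (array_of [(1,2,3), (1,3,2), (1,3,3), (2,1,2), (2,1,2), (2,3,1), (3,1,3), (3,2,1), (3,2,1)])
       + alternating_orbit_sum (array_of [(1,2,3), (1,3,2), (1,3,3), (2,1,1), (2,1,2), (2,3,2), (3,1,1), (3,2,1), (3,2,3)])
       + alternating_orbit_sum (array_of [(1,2,3), (1,3,2), (1,3,2), (2,1,3), (2,2,1), (2,3,1), (3,1,1), (3,1,2), (3,2,3)])
       + alternating_orbit_sum (array_of [(1,2,3), (1,3,2), (1,3,2), (2,1,3), (2,2,1), (2,2,2), (3,1,1), (3,1,1), (3,3,3)])
       + alternating_orbit_sum (array_of [(1,2,3), (1,3,2), (1,3,2), (2,1,3), (2,1,3), (2,3,1), (3,1,2), (3,2,1), (3,2,1)]))"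
proof -
  have "invariant9 f"
    using assms by (simp add: invariant9_def)
  from invariant_expansion[OF this] show ?thesis
    unfolding leading_lists_def array_def place_def
    by (intro exI[of _ "cell_coef f base_list"]) (simp add: add.assoc)
qed

end
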